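(* Let $\mathcal{M}$ be a Sullivan minimal algebra over a field $\mathbb{K}$ of characteristic $0$, and let $\omega\in\mathcal{M}$ be a closed element satisfying: (1) $|\omega|=2r$ for some odd integer $r$, and $[\omega]$ has a representative of the form $\sum_{i=1}^k x_iy_i$ with all $x_i,y_i$ closed elements of $\mathcal{M}^r$; (2) there exists $s\ge 0$ such that $H^s(\mathcal{M})\neq 0$, the map $H^s(\mathcal{M})\to H^{s+2r}(\mathcal{M})$ given by multiplication by $[\omega]$ is an isomorphism, and the map $H^{s-r}(\mathcal{M})\to H^{s+r}(\mathcal{M})$ given by multiplication by $[\omega]$ is injective. Then $\mathcal{M}_\theta=\mathcal{M}\otimes\Lambda\theta$, with $|\theta|=2r-1$ and $d\theta=\omega$, is non-formal.
   Context: A Sullivan minimal algebra is a CDGA $\mathcal{M}=\Lambda V^*$, free as a graded commutative algebra, where $V^*$ has a homogeneous basis $\{v_\alpha\}$ indexed by a well-ordered set such that (1) $dv_\alpha$ lies in the subalgebra generated by the $v_\beta$ with $\beta<\alpha$, and (2) if $|v_\beta|<|v_\alpha|$ then $\beta<\alpha$. A CDGA is formal if it is connected to its cohomology (with zero differential) by a zigzag of quasi-isomorphisms. *)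

theory Defs
  imports Main
begin

text \<open>A CDGA over a field 'k is modelled through its homogeneous elements.
  gr A n is the degree-n component (a 'k-vector space), all components share the zero
  element zr A and intersect only in it.  Addition is only used inside one component.\<close>

record ('k, 'a) cdga =
  gr :: "nat \<Rightarrow> 'a set"
  zr :: 'a
  ad :: "'a \<Rightarrow> 'a \<Rightarrow> 'a"
  sm :: "'k \<Rightarrow> 'a \<Rightarrow> 'a"
  ml :: "'a \<Rightarrow> 'a \<Rightarrow> 'a"
  un :: 'a
  df :: "'a \<Rightarrow> 'a"

definition is_cdga :: "('k::field, 'a) cdga \<Rightarrow> bool" where
  "is_cdga A \<longleftrightarrow>
     (\<forall>n. zr A \<in> gr A n)
   \<and> (\<forall>m n. m \<noteq> n \<longrightarrow> gr A m \<inter> gr A n \<subseteq> {zr A})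
   \<comment> \<open>each component is a 'k-vector space\<close>
   \<and> (\<forall>n. \<forall>x\<in>gr A n. \<forall>y\<in>gr A n. ad A x y \<in> gr A n \<and> ad A x y = ad A y x)
   \<and> (\<forall>n. \<forall>x\<in>gr A n. \<forall>y\<in>gr A n. \<forall>z\<in>gr A n. ad A (ad A x y) z = ad A x (ad A y z))
   \<and> (\<forall>n. \<forall>x\<in>gr A n. ad A (zr A) x = x \<and> (\<exists>y\<in>gr A n. ad A x y = zr A))
   \<and> (\<forall>n c. \<forall>x\<in>gr A n. sm A c x \<in> gr A n)
   \<and> (\<forall>n c. \<forall>x\<in>gr A n. \<forall>y\<in>gr A n. sm A c (ad A x y) = ad A (sm A c x) (sm A c y))
   \<and> (\<forall>n c e. \<forall>x\<in>gr A n. sm A (c + e) x = ad A (sm A c x) (sm A e x)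
                          \<and> sm A (c * e) x = sm A c (sm A e x))
   \<and> (\<forall>n. \<forall>x\<in>gr A n. sm A 1 x = x)
   \<comment> \<open>graded, bilinear, associative, unital, graded-commutative product\<close>
   \<and> (\<forall>m n. \<forall>x\<in>gr A m. \<forall>y\<in>gr A n. ml A x y \<in> gr A (m + n))
   \<and> (\<forall>m n. \<forall>x\<in>gr A m. \<forall>x'\<in>gr A m. \<forall>y\<in>gr A n.
        ml A (ad A x x') y = ad A (ml A x y) (ml A x' y)
      \<and> ml A y (ad A x x') = ad A (ml A y x) (ml A y x'))
   \<and> (\<forall>m n c. \<forall>x\<in>gr A m. \<forall>y\<in>gr A n.
        ml A (sm A c x) y = sm A c (ml A x y) \<and> ml A x (sm A c y) = sm A c (ml A x y))
   \<and> (\<forall>m n p. \<forall>x\<in>gr A m. \<forall>y\<in>gr A n. \<forall>z\<in>gr A p. ml A (ml A x y) z = ml A x (ml A y z))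
   \<and> un A \<in> gr A 0
   \<and> (\<forall>n. \<forall>x\<in>gr A n. ml A (un A) x = x)
   \<and> (\<forall>m n. \<forall>x\<in>gr A m. \<forall>y\<in>gr A n. ml A x y = sm A ((-1) ^ (m * n)) (ml A y x))
   \<comment> \<open>differential of degree +1, linear, square zero, graded Leibniz rule\<close>
   \<and> (\<forall>n. \<forall>x\<in>gr A n. df A x \<in> gr A (Suc n))
   \<and> (\<forall>n. \<forall>x\<in>gr A n. \<forall>y\<in>gr A n. df A (ad A x y) = ad A (df A x) (df A y))
   \<and> (\<forall>n c. \<forall>x\<in>gr A n. df A (sm A c x) = sm A c (df A x))
   \<and> (\<forall>n. \<forall>x\<in>gr A n. df A (df A x) = zr A)
   \<and> (\<forall>m n. \<forall>x\<in>gr A m. \<forall>y\<in>gr A n.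
        df A (ml A x y) = ad A (ml A (df A x) y) (sm A ((-1) ^ m) (ml A x (df A y))))"

definition deg :: "('k, 'a) cdga \<Rightarrow> 'a \<Rightarrow> nat" where
  "deg A x = (LEAST n. x \<in> gr A n)"

definition sub :: "('k::field, 'a) cdga \<Rightarrow> 'a \<Rightarrow> 'a \<Rightarrow> 'a" where
  "sub A x y = ad A x (sm A (-1) y)"

primrec gsum :: "('k, 'a) cdga \<Rightarrow> (nat \<Rightarrow> 'a) \<Rightarrow> nat \<Rightarrow> 'a" where
  "gsum A f 0 = zr A"
| "gsum A f (Suc k) = ad A (gsum A f k) (f k)"

definition cocycle :: "('k, 'a) cdga \<Rightarrow> nat \<Rightarrow> 'a \<Rightarrow> bool" where
  "cocycle A n x \<longleftrightarrow> x \<in> gr A n \<and> df A x = zr A"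

definition coboundary :: "('k, 'a) cdga \<Rightarrow> nat \<Rightarrow> 'a \<Rightarrow> bool" where
  "coboundary A n x \<longleftrightarrow> x \<in> gr A n \<and>
     (x = zr A \<or> (\<exists>m y. n = Suc m \<and> y \<in> gr A m \<and> df A y = x))"

definition cohomologous :: "('k::field, 'a) cdga \<Rightarrow> nat \<Rightarrow> 'a \<Rightarrow> 'a \<Rightarrow> bool" where
  "cohomologous A n x y \<longleftrightarrow> cocycle A n x \<and> cocycle A n y \<and> coboundary A n (sub A x y)"

definition cohom_nonzero :: "('k, 'a) cdga \<Rightarrow> nat \<Rightarrow> bool" where
  "cohom_nonzero A n \<longleftrightarrow> (\<exists>z. cocycle A n z \<and> \<not> coboundary A n z)"

text \<open>The (linear) map H^p(A) \<rightarrow> H^q(A), [z] \<mapsto> [w][z] (w a cocycle of degree q - p) is injective,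
  resp. surjective.\<close>
definition mult_cohom_inj :: "('k, 'a) cdga \<Rightarrow> 'a \<Rightarrow> nat \<Rightarrow> nat \<Rightarrow> bool" where
  "mult_cohom_inj A w p q \<longleftrightarrow>
     (\<forall>z. cocycle A p z \<and> coboundary A q (ml A w z) \<longrightarrow> coboundary A p z)"

definition mult_cohom_surj :: "('k::field, 'a) cdga \<Rightarrow> 'a \<Rightarrow> nat \<Rightarrow> nat \<Rightarrow> bool" where
  "mult_cohom_surj A w p q \<longleftrightarrow>
     (\<forall>y. cocycle A q y \<longrightarrow> (\<exists>z. cocycle A p z \<and> cohomologous A q (ml A w z) y))"

definition is_morph :: "('k::field, 'a) cdga \<Rightarrow> ('k, 'b) cdga \<Rightarrow> ('a \<Rightarrow> 'b) \<Rightarrow> bool" where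
  "is_morph A B f \<longleftrightarrow>
     (\<forall>n. \<forall>x\<in>gr A n. f x \<in> gr B n)
   \<and> (\<forall>n. \<forall>x\<in>gr A n. \<forall>y\<in>gr A n. f (ad A x y) = ad B (f x) (f y))
   \<and> (\<forall>n c. \<forall>x\<in>gr A n. f (sm A c x) = sm B c (f x))
   \<and> (\<forall>m n. \<forall>x\<in>gr A m. \<forall>y\<in>gr A n. f (ml A x y) = ml B (f x) (f y))
   \<and> f (un A) = un B
   \<and> (\<forall>n. \<forall>x\<in>gr A n. f (df A x) = df B (f x))"

definition is_qiso :: "('k::field, 'a) cdga \<Rightarrow> ('k, 'b) cdga \<Rightarrow> ('a \<Rightarrow> 'b) \<Rightarrow> bool" where
  "is_qiso A B f \<longleftrightarrow> is_morph A B f \<and>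
     (\<forall>n. (\<forall>z. cocycle B n z \<longrightarrow> (\<exists>x. cocycle A n x \<and> cohomologous B n (f x) z))
        \<and> (\<forall>x. cocycle A n x \<and> coboundary B n (f x) \<longrightarrow> coboundary A n x))"

definition qlinked :: "('k::field, 'a) cdga \<Rightarrow> ('k, 'b) cdga \<Rightarrow> bool" where
  "qlinked A B \<longleftrightarrow> (\<exists>f. is_qiso A B f) \<or> (\<exists>g. is_qiso B A g)"

text \<open>C (a CDGA with zero differential) is isomorphic, as a graded algebra, to the cohomology
  algebra H(A): psi chooses for each element of C a cocycle representative, and
  c \<mapsto> [psi c] is a degree preserving bijective algebra map C \<rightarrow> H(A).\<close>
definition iso_to_cohom :: "('k::field, 'c) cdga \<Rightarrow> ('k, 'a) cdga \<Rightarrow> bool" where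
  "iso_to_cohom C A \<longleftrightarrow> (\<exists>psi.
     (\<forall>n. \<forall>x\<in>gr C n. cocycle A n (psi x))
   \<and> (\<forall>n. \<forall>x\<in>gr C n. \<forall>y\<in>gr C n. cohomologous A n (psi (ad C x y)) (ad A (psi x) (psi y)))
   \<and> (\<forall>n c. \<forall>x\<in>gr C n. cohomologous A n (psi (sm C c x)) (sm A c (psi x)))
   \<and> (\<forall>m n. \<forall>x\<in>gr C m. \<forall>y\<in>gr C n.
        cohomologous A (m + n) (psi (ml C x y)) (ml A (psi x) (psi y)))
   \<and> cohomologous A 0 (psi (un C)) (un A)
   \<and> (\<forall>n. \<forall>x\<in>gr C n. coboundary A n (psi x) \<longrightarrow> x = zr C)
   \<and> (\<forall>n z. cocycle A n z \<longrightarrow> (\<exists>x\<in>gr C n. cohomologous A n (psi x) z)))"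

text \<open>A is formal: there is a finite zigzag of quasi-isomorphisms
  A -- C_0 -- C_1 -- ... -- C_k, with C_k a CDGA with zero differential isomorphic to H(A).
  The intermediate CDGAs are taken in the type 'c; A is formal iff this holds for some
  (sufficiently large) type 'c, so "not formal" is expressed by negating this for all 'c.\<close>
definition formal :: "'c itself \<Rightarrow> ('k::field, 'a) cdga \<Rightarrow> bool" where
  "formal (_::'c itself) A \<longleftrightarrow> (\<exists>Cs :: ('k, 'c) cdga list.
     Cs \<noteq> [] \<and> (\<forall>C\<in>set Cs. is_cdga C)
   \<and> qlinked A (hd Cs)
   \<and> (\<forall>i. Suc i < length Cs \<longrightarrow> qlinked (Cs ! i) (Cs ! Suc i))
   \<and> (\<forall>n. \<forall>x\<in>gr (last Cs) n. df (last Cs) x = zr (last Cs))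
   \<and> iso_to_cohom (last Cs) A)"

inductive_set subalg :: "('k::field, 'a) cdga \<Rightarrow> 'a set \<Rightarrow> 'a set" for A S where
  sa_un: "un A \<in> subalg A S"
| sa_gen: "s \<in> S \<Longrightarrow> s \<in> subalg A S"
| sa_ad: "x \<in> subalg A S \<Longrightarrow> y \<in> subalg A S \<Longrightarrow> x \<in> gr A n \<Longrightarrow> y \<in> gr A n
           \<Longrightarrow> ad A x y \<in> subalg A S"
| sa_sm: "x \<in> subalg A S \<Longrightarrow> sm A c x \<in> subalg A S"
| sa_ml: "x \<in> subalg A S \<Longrightarrow> y \<in> subalg A S \<Longrightarrow> ml A x y \<in> subalg A S"

definition mprod :: "('k, 'a) cdga \<Rightarrow> 'a list \<Rightarrow> 'a" where
  "mprod A vs = foldr (ml A) vs (un A)"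

definition std_monomial :: "('k, 'a) cdga \<Rightarrow> 'a set \<Rightarrow> 'a rel \<Rightarrow> nat \<Rightarrow> 'a list \<Rightarrow> bool" where
  "std_monomial A G R n vs \<longleftrightarrow> set vs \<subseteq> G \<and> sorted_wrt (\<lambda>u v. (u, v) \<in> R) vs
     \<and> (\<forall>v\<in>set vs. odd (deg A v) \<longrightarrow> count_list vs v \<le> 1)
     \<and> sum_list (map (deg A) vs) = n"

definition lincomb :: "('k, 'a) cdga \<Rightarrow> (nat \<Rightarrow> 'k) \<Rightarrow> 'a list list \<Rightarrow> 'a" where
  "lincomb A cs ms = gsum A (\<lambda>i. sm A (cs i) (mprod A (ms ! i))) (length ms)"

definition free_on :: "('k::field, 'a) cdga \<Rightarrow> 'a set \<Rightarrow> 'a rel \<Rightarrow> bool" where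
  "free_on A G R \<longleftrightarrow> (\<forall>n.
      (\<forall>x\<in>gr A n. \<exists>ms cs. (\<forall>m\<in>set ms. std_monomial A G R n m) \<and> x = lincomb A cs ms)
    \<and> (\<forall>ms cs. distinct ms \<and> (\<forall>m\<in>set ms. std_monomial A G R n m) \<and> lincomb A cs ms = zr A
         \<longrightarrow> (\<forall>i<length ms. cs i = 0)))"

text \<open>Sullivan minimal algebra: free on a homogeneous basis {v_alpha} of V indexed by a
  well-ordered set (here the basis set G itself, well-ordered by R) such that
  (1) d v_alpha lies in the subalgebra generated by the v_beta, beta < alpha, and
  (2) |v_beta| < |v_alpha| implies beta < alpha.\<close>
definition sullivan_minimal :: "('k::field, 'a) cdga \<Rightarrow> bool" where
  "sullivan_minimal A \<longleftrightarrow> is_cdga A \<and> (\<exists>G R.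
      (\<forall>v\<in>G. \<exists>n. v \<in> gr A n \<and> v \<noteq> zr A)
    \<and> well_order_on G R
    \<and> free_on A G R
    \<and> (\<forall>v\<in>G. df A v \<in> subalg A {w\<in>G. (w, v) \<in> R \<and> w \<noteq> v})
    \<and> (\<forall>v\<in>G. \<forall>w\<in>G. deg A w < deg A v \<longrightarrow> (w, v) \<in> R \<and> w \<noteq> v))"

text \<open>The element a + b theta is represented by the pair (a, b).
  (a + b theta)(a' + b' theta) = a a' + (a b' + (-1)^|a'| b a') theta,
  d(a + b theta) = (d a + (-1)^|b| b omega) + (d b) theta.\<close>
definition ext_theta :: "('k::field, 'a) cdga \<Rightarrow> 'a \<Rightarrow> nat \<Rightarrow> ('k, 'a \<times> 'a) cdga" where
  "ext_theta M w r = (let t = 2 * r - 1 in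
     \<lparr> gr = (\<lambda>n. {(a, b). a \<in> gr M n \<and> (if t \<le> n then b \<in> gr M (n - t) else b = zr M)}),
       zr = (zr M, zr M),
       ad = (\<lambda>(a, b) (a', b'). (ad M a a', ad M b b')),
       sm = (\<lambda>c (a, b). (sm M c a, sm M c b)),
       ml = (\<lambda>(a, b) (a', b'). (ml M a a',
               ad M (ml M a b') (sm M ((-1) ^ deg M a') (ml M b a')))),
       un = (un M, zr M),
       df = (\<lambda>(a, b). (ad M (df M a) (sm M ((-1) ^ deg M b) (ml M b w)), df M b)) \<rparr>)"

end

theory Submission
  imports Defs
begin

text \<open>If a has odd degree r and a y is exact, then the triple Massey product of a, a and y is
  defined because a a = 0. It contains 0 in every formal algebra, since this property passes along
  quasi-isomorphisms in both directions and holds when the differential is zero.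

  Let T a b z denote the class u in degree s with [w] u = a b z, which exists and is unique because
  multiplication by [w] is bijective on degree s. In the extension by theta, a primitive of a b z
  has, up to sign, theta-coefficient T a b z, so the vanishing of the Massey product of a, a and b z
  gives a (T a b z) = 0. By polarisation a (T c b z) is alternating in a and c, and hence the
  operators T x y on degree s commute and square to zero. But w is cohomologous to a sum of
  products x_i y_i, so the identity is the sum of the operators T x_i y_i, and the identity of a
  nonzero space is not a sum of finitely many commuting nilpotent operators.\<close>

subsection \<open>Calculus in a commutative differential graded algebra\<close>

locale comm_dga =
  fixes A :: "('k::field_char_0, 'a) cdga"
  assumes is_cdga: "is_cdga A"
begin

lemma zr_in [simp]: "zr A \<in> gr A n"
  using is_cdga unfolding is_cdga_def by (elim conjE) meson

lemma gr_disjoint: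
  assumes "x \<in> gr A m" "x \<in> gr A n" "m \<noteq> n"
  shows "x = zr A"
proof -
  have "gr A m \<inter> gr A n \<subseteq> {zr A}"
    using is_cdga assms(3) unfolding is_cdga_def by (elim conjE) meson
  then show ?thesis using assms by blast
qed

lemma ad_in: "x \<in> gr A n \<Longrightarrow> y \<in> gr A n \<Longrightarrow> ad A x y \<in> gr A n"
  and ad_comm: "x \<in> gr A n \<Longrightarrow> y \<in> gr A n \<Longrightarrow> ad A x y = ad A y x"
  and ad_assoc: "x \<in> gr A n \<Longrightarrow> y \<in> gr A n \<Longrightarrow> z \<in> gr A n \<Longrightarrow>
    ad A (ad A x y) z = ad A x (ad A y z)"
  and ad_zr_left: "x \<in> gr A n \<Longrightarrow> ad A (zr A) x = x"
  using is_cdga unfolding is_cdga_def by - (elim conjE, meson)+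

lemma sm_in: "x \<in> gr A n \<Longrightarrow> sm A c x \<in> gr A n"
  and sm_ad: "x \<in> gr A n \<Longrightarrow> y \<in> gr A n \<Longrightarrow> sm A c (ad A x y) = ad A (sm A c x) (sm A c y)"
  and sm_plus: "x \<in> gr A n \<Longrightarrow> sm A (c + e) x = ad A (sm A c x) (sm A e x)"
  and sm_mult: "x \<in> gr A n \<Longrightarrow> sm A (c * e) x = sm A c (sm A e x)"
  and sm_one: "x \<in> gr A n \<Longrightarrow> sm A 1 x = x"
  and add_inverse: "x \<in> gr A n \<Longrightarrow> \<exists>y\<in>gr A n. ad A x y = zr A"
  using is_cdga unfolding is_cdga_def by - (elim conjE, meson)+

lemma ml_in: "x \<in> gr A m \<Longrightarrow> y \<in> gr A n \<Longrightarrow> k = m + n \<Longrightarrow> ml A x y \<in> gr A k"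
  and ml_ad_left: "x \<in> gr A m \<Longrightarrow> x' \<in> gr A m \<Longrightarrow> y \<in> gr A n \<Longrightarrow>
    ml A (ad A x x') y = ad A (ml A x y) (ml A x' y)"
  and ml_ad_right: "x \<in> gr A m \<Longrightarrow> x' \<in> gr A m \<Longrightarrow> y \<in> gr A n \<Longrightarrow>
    ml A y (ad A x x') = ad A (ml A y x) (ml A y x')"
  and ml_sm_left: "x \<in> gr A m \<Longrightarrow> y \<in> gr A n \<Longrightarrow> ml A (sm A c x) y = sm A c (ml A x y)"
  and ml_sm_right: "x \<in> gr A m \<Longrightarrow> y \<in> gr A n \<Longrightarrow> ml A x (sm A c y) = sm A c (ml A x y)"
  and ml_assoc: "x \<in> gr A m \<Longrightarrow> y \<in> gr A n \<Longrightarrow> z \<in> gr A p \<Longrightarrow>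
    ml A (ml A x y) z = ml A x (ml A y z)"
  and un_in: "un A \<in> gr A 0"
  and ml_un: "x \<in> gr A m \<Longrightarrow> ml A (un A) x = x"
  and ml_comm: "x \<in> gr A m \<Longrightarrow> y \<in> gr A n \<Longrightarrow> ml A x y = sm A ((-1) ^ (m * n)) (ml A y x)"
  using is_cdga unfolding is_cdga_def by - (elim conjE, meson)+

lemma df_in: "x \<in> gr A n \<Longrightarrow> df A x \<in> gr A (Suc n)"
  and df_ad: "x \<in> gr A n \<Longrightarrow> y \<in> gr A n \<Longrightarrow> df A (ad A x y) = ad A (df A x) (df A y)"
  and df_sm: "x \<in> gr A n \<Longrightarrow> df A (sm A c x) = sm A c (df A x)"
  and df_df: "x \<in> gr A n \<Longrightarrow> df A (df A x) = zr A"
  and df_ml: "x \<in> gr A m \<Longrightarrow> y \<in> gr A n \<Longrightarrow>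
    df A (ml A x y) = ad A (ml A (df A x) y) (sm A ((-1) ^ m) (ml A x (df A y)))"
  using is_cdga unfolding is_cdga_def by - (elim conjE, meson)+

section \<open>Linear algebra within one degree\<close>

lemma ad_zr_right: "x \<in> gr A n \<Longrightarrow> ad A x (zr A) = x"
  by (simp add: ad_comm[of x n "zr A"] ad_zr_left)

lemma ad_left_comm:
  assumes "x \<in> gr A n" "y \<in> gr A n" "z \<in> gr A n"
  shows "ad A x (ad A y z) = ad A y (ad A x z)"
proof -
  have "ad A x (ad A y z) = ad A (ad A x y) z" by (simp add: ad_assoc[of _ n] assms)
  also have "\<dots> = ad A (ad A y x) z" by (simp only: ad_comm[OF assms(1,2)])
  also have "\<dots> = ad A y (ad A x z)" by (simp add: ad_assoc[of _ n] assms)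
  finally show ?thesis .
qed

lemma ad_medial:
  assumes "x \<in> gr A n" "y \<in> gr A n" "z \<in> gr A n" "u \<in> gr A n"
  shows "ad A (ad A x y) (ad A z u) = ad A (ad A x z) (ad A y u)"
  using assms by (simp add: ad_assoc[of _ n] ad_left_comm[of _ n] ad_in)

lemma ad_cancel_left:
  assumes "x \<in> gr A n" "y \<in> gr A n" "z \<in> gr A n" "ad A x y = ad A x z"
  shows "y = z"
proof -
  obtain x' where x': "x' \<in> gr A n" "ad A x x' = zr A" using add_inverse assms by blast
  then have "ad A x' x = zr A" using ad_comm assms by metis
  then have "ad A x' (ad A x u) = u" if "u \<in> gr A n" for u
    using that x' assms by (metis ad_assoc ad_zr_left)
  then show ?thesis using assms by metis
qed

lemma sm_zero: assumes "x \<in> gr A n" shows "sm A 0 x = zr A"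
proof (rule ad_cancel_left)
  show "ad A (sm A 0 x) (sm A 0 x) = ad A (sm A 0 x) (zr A)"
    using sm_plus[OF assms, of 0 0] assms by (simp add: ad_zr_right[of _ n] sm_in)
qed (use assms sm_in in auto)

lemma sm_zr [simp]: "sm A c (zr A) = zr A"
  using sm_mult[of "zr A" 0 c 0] sm_zero[of "zr A" 0] by simp

lemma ad_neg_right: "x \<in> gr A n \<Longrightarrow> ad A x (sm A (-1) x) = zr A"
  using sm_plus[of x n 1 "-1"] by (simp add: sm_zero sm_one)

lemma ad_neg_left: "x \<in> gr A n \<Longrightarrow> ad A (sm A (-1) x) x = zr A"
  by (metis ad_comm ad_neg_right sm_in)

lemma neg_neg: "x \<in> gr A n \<Longrightarrow> sm A (-1) (sm A (-1) x) = x"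
  using sm_mult[of x n "-1" "-1"] by (simp add: sm_one)

lemma ad_ad_neg: "x \<in> gr A n \<Longrightarrow> y \<in> gr A n \<Longrightarrow> ad A (ad A x y) (sm A (-1) y) = x"
  by (metis ad_assoc ad_neg_right ad_zr_right sm_in)

lemma ad_neg_ad: "x \<in> gr A n \<Longrightarrow> y \<in> gr A n \<Longrightarrow> ad A (ad A x (sm A (-1) y)) y = x"
  by (metis ad_assoc ad_neg_left ad_zr_right sm_in)

lemma zr_ad_zr [simp]: "ad A (zr A) (zr A) = zr A"
  by (rule ad_zr_left[of _ 0]) simp

lemma ml_zr_left: "y \<in> gr A n \<Longrightarrow> ml A (zr A) y = zr A"
  by (metis ml_in ml_sm_left sm_zero zr_in)

lemma ml_zr_right: "y \<in> gr A n \<Longrightarrow> ml A y (zr A) = zr A"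
  by (metis ml_in ml_sm_right sm_zero zr_in)

lemma df_zr [simp]: "df A (zr A) = zr A"
  by (metis df_in df_sm sm_zero zr_in)

text \<open>Graded commutativity gives x x = - x x in odd degree, and 2 is invertible in
  characteristic 0.\<close>

lemma odd_square_zero:
  assumes "x \<in> gr A r" "odd r"
  shows "ml A x x = zr A"
proof -
  have xx: "ml A x x \<in> gr A (r + r)" by (rule ml_in) (use assms in auto)
  have "ml A x x = sm A (-1) (ml A x x)" using ml_comm[OF assms(1,1)] assms by simp
  then have "ad A (ml A x x) (ml A x x) = zr A" using ad_neg_right[OF xx] by metis
  then have "sm A (1 + 1) (ml A x x) = zr A" by (simp only: sm_plus[OF xx] sm_one[OF xx])
  then have "sm A (inverse 2 * 2) (ml A x x) = zr A"
    using sm_mult[OF xx, of "inverse 2" 2] by simp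
  then show ?thesis using xx sm_one by simp
qed

text \<open>Zero lies in every component, so \<open>deg\<close> assigns it 0 as the least possible
  value; any other element lies in a single component.\<close>

lemma deg_eq: "x \<in> gr A n \<Longrightarrow> x \<noteq> zr A \<Longrightarrow> deg A x = n"
  unfolding deg_def by (rule Least_equality) (use gr_disjoint in fastforce)+

lemma sub_in: "x \<in> gr A n \<Longrightarrow> y \<in> gr A n \<Longrightarrow> sub A x y \<in> gr A n"
  unfolding sub_def by (simp add: ad_in sm_in)

section \<open>Cocycles and coboundaries\<close>

lemma cocycle_in: "cocycle A n x \<Longrightarrow> x \<in> gr A n"
  and coboundary_in: "coboundary A n x \<Longrightarrow> x \<in> gr A n"
  by (auto simp: cocycle_def coboundary_def)

lemma cocycle_zr [simp]: "cocycle A n (zr A)"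
  and coboundary_zr [simp]: "coboundary A n (zr A)"
  by (auto simp: cocycle_def coboundary_def)

lemma cocycle_ad: "cocycle A n x \<Longrightarrow> cocycle A n y \<Longrightarrow> cocycle A n (ad A x y)"
  by (auto simp: cocycle_def ad_in df_ad)

lemma cocycle_sm: "cocycle A n x \<Longrightarrow> cocycle A n (sm A c x)"
  by (auto simp: cocycle_def sm_in df_sm)

lemma cocycle_ml: "cocycle A m x \<Longrightarrow> cocycle A n y \<Longrightarrow> k = m + n \<Longrightarrow> cocycle A k (ml A x y)"
  by (auto simp: cocycle_def ml_in df_ml ml_zr_left ml_zr_right)

lemma cocycle_sub: "cocycle A n x \<Longrightarrow> cocycle A n y \<Longrightarrow> cocycle A n (sub A x y)"
  by (simp add: sub_def cocycle_ad cocycle_sm)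

lemma coboundary_df: "x \<in> gr A n \<Longrightarrow> k = Suc n \<Longrightarrow> coboundary A k (df A x)"
  by (auto simp: coboundary_def df_in)

text \<open>The separate clause for zero in \<open>coboundary\<close> matters only in degree 0,
  where no lower degree can supply a primitive; in positive degree zero is the differential of
  zero.\<close>

lemma coboundary_Suc_iff: "coboundary A (Suc n) x \<longleftrightarrow> (\<exists>y\<in>gr A n. df A y = x)"
proof -
  have "\<exists>y\<in>gr A n. df A y = zr A" by (rule bexI[of _ "zr A"]) auto
  then show ?thesis by (auto simp: coboundary_def df_in)
qed

lemma coboundary_0_iff: "coboundary A 0 x \<longleftrightarrow> x = zr A"
  by (auto simp: coboundary_def)

lemma coboundary_ad: "coboundary A n x \<Longrightarrow> coboundary A n y \<Longrightarrow> coboundary A n (ad A x y)"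
  by (cases n) (auto simp: coboundary_Suc_iff coboundary_0_iff, metis ad_in df_ad)

lemma coboundary_sm: "coboundary A n x \<Longrightarrow> coboundary A n (sm A c x)"
  by (cases n) (auto simp: coboundary_Suc_iff coboundary_0_iff, metis sm_in df_sm)

lemma coboundary_sub: "coboundary A n x \<Longrightarrow> coboundary A n y \<Longrightarrow> coboundary A n (sub A x y)"
  by (simp add: sub_def coboundary_ad coboundary_sm)

lemma coboundary_ad_cancel:
  assumes "coboundary A n (ad A x y)" "coboundary A n y" "x \<in> gr A n"
  shows "coboundary A n x"
  using coboundary_ad[OF assms(1) coboundary_sm[OF assms(2), of "-1"]] ad_ad_neg[OF assms(3)]
    coboundary_in[OF assms(2)] by simp

lemma coboundary_sub_cancel:
  assumes "coboundary A n (sub A x y)" "coboundary A n y" "x \<in> gr A n"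
  shows "coboundary A n x"
  using coboundary_ad_cancel[OF _ coboundary_sm[OF assms(2)] assms(3)] assms(1)
  unfolding sub_def by blast

lemma coboundary_neg_iff: "x \<in> gr A n \<Longrightarrow> coboundary A n (sm A (-1) x) \<longleftrightarrow> coboundary A n x"
  by (metis coboundary_sm neg_neg)

lemma sub_swap: "x \<in> gr A n \<Longrightarrow> y \<in> gr A n \<Longrightarrow> sub A y x = sm A (-1) (sub A x y)"
  by (simp add: sub_def sm_ad[of _ n] sm_in neg_neg[of _ n] ad_comm[of y n])

lemma coboundary_sub_sym:
  "x \<in> gr A n \<Longrightarrow> y \<in> gr A n \<Longrightarrow> coboundary A n (sub A x y) \<Longrightarrow> coboundary A n (sub A y x)"
  by (metis coboundary_sm sub_swap)

text \<open>If d u = y and x is closed of degree m, then d (x u) = (-1)^m x y. The sign is its own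
  inverse, so (-1)^m x u is a primitive of x y.\<close>

lemma coboundary_ml_right:
  assumes x: "cocycle A m x" and y: "coboundary A n y" and k: "k = m + n"
  shows "coboundary A k (ml A x y)"
proof (cases n)
  case 0
  then show ?thesis using assms by (simp add: coboundary_0_iff ml_zr_right[OF cocycle_in])
next
  case (Suc n')
  then obtain u where u: "u \<in> gr A n'" "df A u = y" using y coboundary_Suc_iff by blast
  have "ml A (df A x) u = zr A" using x u by (simp add: cocycle_def ml_zr_left)
  then have "df A (ml A x u) = sm A ((-1) ^ m) (ml A x y)"
    using df_ml[OF cocycle_in[OF x] u(1)] u ad_zr_left[OF sm_in[OF ml_in]]
      cocycle_in[OF x] coboundary_in[OF y] by simp
  then have "df A (sm A ((-1) ^ m) (ml A x u)) = ml A x y"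
    using df_sm[OF ml_in[OF cocycle_in[OF x] u(1) refl]]
      sm_mult[OF ml_in[OF cocycle_in[OF x] coboundary_in[OF y] refl], of "(-1)^m" "(-1)^m"]
      sm_one[OF ml_in[OF cocycle_in[OF x] coboundary_in[OF y] refl]]
    by (simp flip: power_mult_distrib)
  moreover have "sm A ((-1) ^ m) (ml A x u) \<in> gr A (m + n')"
    by (intro sm_in ml_in[OF cocycle_in[OF x] u(1)] refl)
  ultimately show ?thesis using Suc k coboundary_df by fastforce
qed

lemma coboundary_ml_comm:
  assumes "x \<in> gr A m" "y \<in> gr A n" "coboundary A k (ml A x y)"
  shows "coboundary A k (ml A y x)"
  using coboundary_sm[OF assms(3)] ml_comm[OF assms(2,1)] by simp

lemma coboundary_ml_left:
  assumes "coboundary A m x" "cocycle A n y" "k = m + n"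
  shows "coboundary A k (ml A x y)"
proof (rule coboundary_ml_comm[OF cocycle_in[OF assms(2)] coboundary_in[OF assms(1)]])
  show "coboundary A k (ml A y x)"
    using coboundary_ml_right[OF assms(2,1)] assms(3) by (simp add: add.commute)
qed

end

subsection \<open>Massey products of the form (a, a, y)\<close>

text \<open>Here q is the degree of a primitive of a y, so Suc q = r + m when y has degree m.\<close>

definition null_massey :: "('k::field, 'a) cdga \<Rightarrow> nat \<Rightarrow> nat \<Rightarrow> 'a \<Rightarrow> 'a \<Rightarrow> bool" where
  "null_massey A r q a y \<longleftrightarrow>
     (\<exists>p\<in>gr A q. df A p = ml A a y \<and> coboundary A (r + q) (ml A a p))"

text \<open>For odd r the square a a is zero, so zero can be fixed as its primitive and the Massey
  product is represented, up to sign, by a p alone. The remaining freedom is the choice of p, and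
  one p with a p exact is asked for.\<close>

definition massey_vanishing :: "('k::field, 'a) cdga \<Rightarrow> nat \<Rightarrow> nat \<Rightarrow> nat \<Rightarrow> bool" where
  "massey_vanishing A r m q \<longleftrightarrow>
     (\<forall>a y. cocycle A r a \<and> cocycle A m y \<and> coboundary A (r + m) (ml A a y)
        \<longrightarrow> null_massey A r q a y)"

context comm_dga
begin

text \<open>Cohomologous elements differ by some d e; the case of equality covers degree 0, where
  there is no degree for e to live in.\<close>

lemma coboundary_subE:
  assumes "coboundary A n (sub A x y)" "x \<in> gr A n" "y \<in> gr A n"
  obtains "x = y" | n' e where "n = Suc n'" "e \<in> gr A n'" "x = ad A y (df A e)"
proof -
  have x: "x = ad A y (sub A x y)"
    using ad_neg_ad[OF assms(2,3)] ad_comm[OF sub_in[OF assms(2,3)] assms(3)]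
    by (simp add: sub_def)
  show ?thesis
  proof (cases n)
    case 0
    then show ?thesis using that(1) x assms coboundary_0_iff ad_zr_right by metis
  next
    case (Suc n')
    then show ?thesis using that(2) x assms coboundary_Suc_iff by metis
  qed
qed

lemma ml_sub_left:
  assumes "x \<in> gr A m" "x' \<in> gr A m" "y \<in> gr A n"
  shows "ml A (sub A x x') y = sub A (ml A x y) (ml A x' y)"
  using assms by (simp add: sub_def ml_ad_left[of _ m _ _ n] ml_sm_left[of _ m _ n] sm_in)

lemma ml_sub_right:
  assumes "x \<in> gr A m" "x' \<in> gr A m" "y \<in> gr A n"
  shows "ml A y (sub A x x') = sub A (ml A y x) (ml A y x')"
  using assms by (simp add: sub_def ml_ad_right[of _ m _ _ n] ml_sm_right[of _ n _ m] sm_in)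

lemma df_sub: "x \<in> gr A n \<Longrightarrow> y \<in> gr A n \<Longrightarrow> df A (sub A x y) = sub A (df A x) (df A y)"
  by (simp add: sub_def df_ad[of _ n] df_sm[of _ n] sm_in)

lemma sub_self: "x \<in> gr A n \<Longrightarrow> sub A x x = zr A"
  by (simp add: sub_def ad_neg_right)

lemma sub_zr: "x \<in> gr A n \<Longrightarrow> sub A x (zr A) = x"
  by (simp add: sub_def ad_zr_right)

text \<open>Exactness of a product of cocycles depends on the two classes only; the factors are
  replaced one at a time.\<close>

lemma coboundary_ml_congruent:
  assumes x: "cocycle A n x" "cocycle A n x'" "coboundary A n (sub A x x')"
    and y: "cocycle A m y" "cocycle A m y'" "coboundary A m (sub A y y')"
    and xy: "coboundary A (n + m) (ml A x' y')"
  shows "coboundary A (n + m) (ml A x y)"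
proof -
  note g = x(1,2)[THEN cocycle_in] y(1,2)[THEN cocycle_in]
  have "coboundary A (n + m) (sub A (ml A x' y) (ml A x' y'))"
    using coboundary_ml_right[OF x(2) y(3) refl] ml_sub_right[OF g(3,4,2)] by simp
  then have 1: "coboundary A (n + m) (ml A x' y)"
    using coboundary_sub_cancel xy ml_in[OF g(2,3) refl] by blast
  have "coboundary A (n + m) (sub A (ml A x y) (ml A x' y))"
    using coboundary_ml_left[OF x(3) y(1) refl] ml_sub_left[OF g(1,2,3)] by simp
  then show ?thesis
    using coboundary_sub_cancel 1 ml_in[OF g(1,3) refl] by blast
qed

text \<open>The new primitive is p - a e. Since a is closed of odd degree, d (a e) = - a (d e), and
  since a a = 0, multiplying by a does not see the correction: a (p - a e) = a p.\<close>

lemma null_massey_add_df_right: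
  assumes a: "cocycle A r a" "odd r" and y: "y \<in> gr A m" and e: "e \<in> gr A m'" "m = Suc m'"
    and q: "Suc q = r + m" and null: "null_massey A r q a y"
  shows "null_massey A r q a (ad A y (df A e))"
proof -
  obtain p where p: "p \<in> gr A q" "df A p = ml A a y" "coboundary A (r + q) (ml A a p)"
    using null unfolding null_massey_def by blast
  have ag: "a \<in> gr A r" using a cocycle_in by blast
  have de: "df A e \<in> gr A m" using df_in e by simp
  have ae: "ml A a e \<in> gr A q" using ml_in[OF ag e(1)] q e by simp
  have ade: "ml A a (df A e) \<in> gr A (Suc q)" using ml_in[OF ag de] q by simp
  have dae: "df A (ml A a e) = sm A (-1) (ml A a (df A e))"
    using df_ml[OF ag e(1)] a ml_zr_left[OF e(1)] ad_zr_left[OF sm_in[OF ade]]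
    by (simp add: cocycle_def)
  have aae: "ml A a (ml A a e) = zr A"
    using ml_assoc[OF ag ag e(1)] odd_square_zero[OF ag a(2)] ml_zr_left[OF e(1)] by simp
  let ?p = "sub A p (ml A a e)"
  have "df A ?p = ad A (ml A a y) (ml A a (df A e))"
    using df_sub[OF p(1) ae] p(2) dae neg_neg[OF ade] by (simp add: sub_def)
  then have "df A ?p = ml A a (ad A y (df A e))" using ml_ad_right[OF y de ag] by simp
  moreover have "ml A a ?p = ml A a p"
    using ml_sub_right[OF p(1) ae ag] aae sub_zr[OF ml_in[OF ag p(1) refl]] by simp
  ultimately show ?thesis
    unfolding null_massey_def using p(3) sub_in[OF p(1) ae] by force
qed

text \<open>This is half of the differential of e e, and the reason why two must be invertible.\<close>

lemma coboundary_df_mult_self: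
  assumes e: "e \<in> gr A n" "even n"
  shows "coboundary A (Suc n + n) (ml A (df A e) e)"
proof -
  have de: "df A e \<in> gr A (Suc n)" using df_in e by simp
  have g: "ml A (df A e) e \<in> gr A (Suc n + n)" using ml_in[OF de e(1)] by simp
  have "ml A e (df A e) = ml A (df A e) e"
    using ml_comm[OF e(1) de] e(2) sm_one[OF g] by simp
  then have "df A (ml A e e) = sm A (1 + 1) (ml A (df A e) e)"
    using df_ml[OF e(1) e(1)] e(2) sm_one[OF g] by (simp only: sm_plus[OF g]) simp
  then have "sm A (inverse 2) (df A (ml A e e)) = ml A (df A e) e"
    using sm_mult[OF g, of "inverse 2" 2] sm_one[OF g] by simp
  moreover have "coboundary A (Suc n + n) (df A (ml A e e))"
    using coboundary_df[OF ml_in[OF e(1) e(1) refl]] by simp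
  ultimately show ?thesis using coboundary_sm by metis
qed

text \<open>The new primitive is p + e y, with d (e y) = (d e) y. Then (a + d e) (p + e y) is the
  sum of a p, of (d e) p + a e y and of (d e) e y. The first is exact by assumption, the second is d
  (e p) because e has even degree and so commutes with a, and the third is exact by
  \<open>coboundary_df_mult_self\<close>.\<close>

lemma null_massey_add_df_left:
  assumes a: "cocycle A r a" "odd r" and y: "cocycle A m y" and e: "e \<in> gr A r'" "r = Suc r'"
    and q: "Suc q = r + m" and null: "null_massey A r q a y"
  shows "null_massey A r q (ad A a (df A e)) y"
proof -
  obtain p where p: "p \<in> gr A q" "df A p = ml A a y" "coboundary A (r + q) (ml A a p)"
    using null unfolding null_massey_def by blast
  have ag: "a \<in> gr A r" and yg: "y \<in> gr A m" using a y cocycle_in by blast+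
  have ev: "even r'" using a e by simp
  have de: "df A e \<in> gr A r" using df_in e by simp
  have ey: "ml A e y \<in> gr A q" using ml_in[OF e(1) yg] q e by simp
  have dey: "df A (ml A e y) = ml A (df A e) y"
    using df_ml[OF e(1) yg] y ml_zr_right[OF e(1)] ad_zr_right[OF ml_in[OF de yg refl]]
    by (simp add: cocycle_def)
  let ?p = "ad A p (ml A e y)" and ?a = "ad A a (df A e)"
  have dp: "df A ?p = ml A ?a y"
    using df_ad[OF p(1) ey] p(2) dey ml_ad_left[OF ag de yg] by simp
  let ?X = "ml A a p" and ?Y = "ml A a (ml A e y)" and ?Z = "ml A (df A e) p"
    and ?W = "ml A (df A e) (ml A e y)"
  have g: "?X \<in> gr A (r + q)" "?Y \<in> gr A (r + q)" "?Z \<in> gr A (r + q)" "?W \<in> gr A (r + q)"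
    using ml_in[OF ag p(1)] ml_in[OF ag ey] ml_in[OF de p(1)] ml_in[OF de ey] by auto
  have ea: "ml A e a = ml A a e"
    using ml_comm[OF e(1) ag] ev sm_one[OF ml_in[OF ag e(1) refl]] by simp
  have "ml A e (ml A a y) = ?Y"
    using ml_assoc[OF e(1) ag yg] ml_assoc[OF ag e(1) yg] ea by simp
  then have "df A (ml A e p) = ad A ?Z ?Y"
    using df_ml[OF e(1) p(1)] p(2) ev sm_one[OF g(2)] by simp
  moreover have "coboundary A (r + q) (df A (ml A e p))"
    by (rule coboundary_df[OF ml_in[OF e(1) p(1) refl]]) (use e in simp)
  ultimately have ZY: "coboundary A (r + q) (ad A ?Z ?Y)" by simp
  have "coboundary A (r + q) (ml A (ml A (df A e) e) y)"
    by (rule coboundary_ml_left[OF coboundary_df_mult_self[OF e(1) ev] y]) (use e q in simp)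
  then have W: "coboundary A (r + q) ?W" using ml_assoc[OF de e(1) yg] by simp
  have "ml A ?a ?p = ad A (ml A ?a p) (ml A ?a (ml A e y))"
    using ml_ad_right[OF p(1) ey ad_in[OF ag de]] .
  also have "\<dots> = ad A (ad A ?X ?Z) (ad A ?Y ?W)"
    using ml_ad_left[OF ag de p(1)] ml_ad_left[OF ag de ey] by simp
  also have "\<dots> = ad A (ad A ?X ?W) (ad A ?Z ?Y)"
    using g by (simp add: ad_assoc[of _ "r + q"] ad_left_comm[of _ "r + q"] ad_comm[of _ "r + q"] ad_in)
  finally have "coboundary A (r + q) (ml A ?a ?p)"
    using coboundary_ad[OF coboundary_ad[OF p(3) W] ZY] by simp
  then show ?thesis unfolding null_massey_def using dp ad_in[OF p(1) ey] by blast
qed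

lemma null_massey_cohomologous:
  assumes r: "odd r" "Suc q = r + m"
    and a: "cohomologous A r a' a" and y: "cohomologous A m y' y"
    and null: "null_massey A r q a y"
  shows "null_massey A r q a' y'"
proof -
  have c: "cocycle A r a" "cocycle A r a'" "cocycle A m y" "cocycle A m y'"
    using a y by (auto simp: cohomologous_def)
  note g = c[THEN cocycle_in]
  have "coboundary A r (sub A a' a)" using a by (simp add: cohomologous_def)
  then have 1: "null_massey A r q a' y"
    by (rule coboundary_subE[OF _ g(2,1)])
      (use null null_massey_add_df_left[OF c(1) r(1) c(3) _ _ r(2) null] in auto)
  have "coboundary A m (sub A y' y)" using y by (simp add: cohomologous_def)
  then show ?thesis
    by (rule coboundary_subE[OF _ g(4,3)])
      (use 1 null_massey_add_df_right[OF c(2) r(1) g(3) _ _ r(2) 1] in auto)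
qed

text \<open>Without a differential exact means zero, so a y = 0 and p = 0 is a primitive with a p =
  0.\<close>

lemma massey_vanishing_zero_differential:
  assumes z: "\<And>n x. x \<in> gr A n \<Longrightarrow> df A x = zr A"
  shows "massey_vanishing A r m q"
  unfolding massey_vanishing_def null_massey_def
proof (intro allI impI, elim conjE)
  fix a y
  assume a: "cocycle A r a" and ay: "coboundary A (r + m) (ml A a y)"
  have "ml A a y = zr A" using ay z by (auto simp: coboundary_def)
  then show "\<exists>p\<in>gr A q. df A p = ml A a y \<and> coboundary A (r + q) (ml A a p)"
    using ml_zr_right[OF cocycle_in[OF a]] by (intro bexI[of _ "zr A"]) auto
qed

end

section \<open>Transfer of vanishing Massey products along quasi-isomorphisms\<close>

locale quasi_iso = A: comm_dga A + B: comm_dga B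
  for A :: "('k::field_char_0, 'a) cdga" and B :: "('k, 'b) cdga" +
  fixes f :: "'a \<Rightarrow> 'b"
  assumes is_qiso: "is_qiso A B f"
begin

lemma morph: "is_morph A B f" using is_qiso by (simp add: is_qiso_def)

lemma f_in: "x \<in> gr A n \<Longrightarrow> f x \<in> gr B n"
  and f_ad: "x \<in> gr A n \<Longrightarrow> y \<in> gr A n \<Longrightarrow> f (ad A x y) = ad B (f x) (f y)"
  and f_sm: "x \<in> gr A n \<Longrightarrow> f (sm A c x) = sm B c (f x)"
  and f_ml: "x \<in> gr A m \<Longrightarrow> y \<in> gr A n \<Longrightarrow> f (ml A x y) = ml B (f x) (f y)"
  and f_df: "x \<in> gr A n \<Longrightarrow> f (df A x) = df B (f x)"
  using morph unfolding is_morph_def by - (elim conjE, meson)+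

lemma lift_cocycle:
  "cocycle B n z \<Longrightarrow> \<exists>x. cocycle A n x \<and> cohomologous B n (f x) z"
  and reflect_coboundary:
  "cocycle A n x \<Longrightarrow> coboundary B n (f x) \<Longrightarrow> coboundary A n x"
  using is_qiso unfolding is_qiso_def by blast+

lemma f_zr: "f (zr A) = zr B"
  using f_sm[OF A.zr_in[of 0], of 0] B.sm_zero[OF f_in[OF A.zr_in[of 0]]] by simp

lemma f_sub: "x \<in> gr A n \<Longrightarrow> y \<in> gr A n \<Longrightarrow> f (sub A x y) = sub B (f x) (f y)"
  by (simp add: sub_def f_ad[of _ n] f_sm[of _ n] A.sm_in)

lemma f_cocycle: "cocycle A n x \<Longrightarrow> cocycle B n (f x)"
  unfolding cocycle_def by (metis f_df f_in f_zr)

lemma f_coboundary: "coboundary A n x \<Longrightarrow> coboundary B n (f x)"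
  by (cases n) (auto simp: A.coboundary_Suc_iff A.coboundary_0_iff f_zr f_df
      intro!: B.coboundary_df f_in)

text \<open>Both classes of B are lifted to A, where exactness of the product is reflected. The
  image of a good primitive in A is good for the images f a and f y, and a change of representatives
  leads back to the given cocycles.\<close>

lemma massey_vanishing_push:
  assumes r: "odd r" "Suc q = r + m" and A: "massey_vanishing A r m q"
  shows "massey_vanishing B r m q"
  unfolding massey_vanishing_def
proof (intro allI impI, elim conjE)
  fix a' y'
  assume ay': "cocycle B r a'" "cocycle B m y'" "coboundary B (r + m) (ml B a' y')"
  obtain a where a: "cocycle A r a" "cohomologous B r (f a) a'" using lift_cocycle ay' by blast
  obtain y where y: "cocycle A m y" "cohomologous B m (f y) y'" using lift_cocycle ay' by blast
  note g = a(1)[THEN A.cocycle_in] y(1)[THEN A.cocycle_in]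
  have "coboundary B (r + m) (ml B (f a) (f y))"
    using B.coboundary_ml_congruent ay' a(2) y(2) unfolding cohomologous_def by blast
  then have "coboundary A (r + m) (ml A a y)"
    using reflect_coboundary[OF A.cocycle_ml[OF a(1) y(1) refl]] f_ml[OF g] by simp
  then obtain p where p: "p \<in> gr A q" "df A p = ml A a y" "coboundary A (r + q) (ml A a p)"
    using A a y unfolding massey_vanishing_def null_massey_def by blast
  have "df B (f p) = ml B (f a) (f y)" using p f_df[OF p(1)] f_ml[OF g] by simp
  moreover have "coboundary B (r + q) (ml B (f a) (f p))"
    using f_coboundary[OF p(3)] f_ml[OF g(1) p(1)] by simp
  ultimately have "null_massey B r q (f a) (f y)"
    unfolding null_massey_def using f_in[OF p(1)] by blast
  moreover have "cohomologous B r a' (f a)" "cohomologous B m y' (f y)"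
    using a(2) y(2) B.coboundary_sub_sym unfolding cohomologous_def
    by (auto dest: B.cocycle_in)
  ultimately show "null_massey B r q a' y'" using B.null_massey_cohomologous r by blast
qed

text \<open>A primitive p of a y in A need not be good, but f p differs from a good primitive u in B
  by a cocycle. Subtracting from p a cocycle of A that represents this difference makes a p exact in
  B after applying f, hence exact in A.\<close>

lemma massey_vanishing_pull:
  assumes r: "odd r" "Suc q = r + m" and B: "massey_vanishing B r m q"
  shows "massey_vanishing A r m q"
  unfolding massey_vanishing_def
proof (intro allI impI, elim conjE)
  fix a y
  assume ay: "cocycle A r a" "cocycle A m y" "coboundary A (r + m) (ml A a y)"
  note g = ay(1,2)[THEN A.cocycle_in]
  obtain p where p: "p \<in> gr A q" "df A p = ml A a y"
    using ay(3) A.coboundary_Suc_iff[of q] r(2) by metis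
  have "coboundary B (r + m) (ml B (f a) (f y))"
    using f_coboundary[OF ay(3)] f_ml[OF g] by simp
  then obtain u where u: "u \<in> gr B q" "df B u = ml B (f a) (f y)"
      "coboundary B (r + q) (ml B (f a) u)"
    using B f_cocycle ay unfolding massey_vanishing_def null_massey_def by meson
  have fp: "f p \<in> gr B q" using f_in p by blast
  have "df B (f p) = df B u" using f_df[OF p(1)] p(2) u(2) f_ml[OF g] by simp
  then have "cocycle B q (sub B (f p) u)"
    using B.df_sub[OF fp u(1)] B.sub_self[OF B.df_in[OF u(1)]] B.sub_in[OF fp u(1)]
    by (simp add: cocycle_def)
  then obtain c where c: "cocycle A q c" "cohomologous B q (f c) (sub B (f p) u)"
    using lift_cocycle by blast
  have cg: "c \<in> gr A q" and fc: "f c \<in> gr B q" using c(1) A.cocycle_in f_in by blast+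
  let ?p = "sub A p c"
  have pg: "?p \<in> gr A q" using A.sub_in p(1) cg by blast
  have dp: "df A ?p = ml A a y"
    using A.df_sub[OF p(1) cg] p(2) c(1) A.sub_zr[OF A.ml_in[OF g refl]] by (simp add: cocycle_def)
  \<comment> \<open>This makes a (p - c) closed, as is needed before exactness of its image can be
    reflected to A.\<close>
  have aay: "ml A a (ml A a y) = zr A"
    using A.ml_assoc[OF g(1,1,2)] A.odd_square_zero[OF g(1) r(1)] A.ml_zr_left[OF g(2)] by simp
  have ap: "cocycle A (r + q) (ml A a ?p)"
    using A.df_ml[OF g(1) pg] A.ml_in[OF g(1) pg refl] dp aay A.ml_zr_left[OF pg] ay(1)
    by (simp add: cocycle_def)
  have "sub B (f ?p) u = sub B (sub B (f p) u) (f c)"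
    unfolding f_sub[OF p(1) cg] unfolding sub_def
    using fp fc u(1)
    by (simp add: B.ad_assoc[of _ q] B.sm_in B.ad_comm[of "sm B (-1) (f c)" q])
  moreover have "coboundary B q (sub B (sub B (f p) u) (f c))"
    using c(2) B.coboundary_sub_sym unfolding cohomologous_def by (auto dest: B.cocycle_in)
  ultimately have "coboundary B (r + q) (ml B (f a) (sub B (f ?p) u))"
    using B.coboundary_ml_right[OF f_cocycle[OF ay(1)]] by simp
  then have "coboundary B (r + q) (sub B (ml B (f a) (f ?p)) (ml B (f a) u))"
    using B.ml_sub_right[OF f_in[OF pg] u(1) f_in[OF g(1)]] by simp
  then have "coboundary B (r + q) (ml B (f a) (f ?p))"
    using B.coboundary_sub_cancel[OF _ u(3)] B.ml_in[OF f_in[OF g(1)] f_in[OF pg] refl] by blast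
  then have "coboundary A (r + q) (ml A a ?p)"
    using reflect_coboundary[OF ap] f_ml[OF g(1) pg] by simp
  then show "null_massey A r q a y" unfolding null_massey_def using dp pg by blast
qed

end

lemma massey_vanishing_qlinked:
  fixes A :: "('k::field_char_0, 'a) cdga" and B :: "('k, 'b) cdga"
  assumes "is_cdga A" "is_cdga B" "qlinked A B" "odd r" "Suc q = r + m"
    and B: "massey_vanishing B r m q"
  shows "massey_vanishing A r m q"
  using assms(3) unfolding qlinked_def
proof (elim disjE exE)
  fix f assume "is_qiso A B f"
  then interpret quasi_iso A B f using assms(1,2) by unfold_locales
  show ?thesis using massey_vanishing_pull assms by blast
next
  fix f assume "is_qiso B A f"
  then interpret quasi_iso B A f using assms(1,2) by unfold_locales
  show ?thesis using massey_vanishing_push assms by blast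
qed

section \<open>Zigzags and formality\<close>

lemma massey_vanishing_zigzag:
  fixes Cs :: "('k::field_char_0, 'c) cdga list"
  assumes "Cs \<noteq> []" "\<forall>C\<in>set Cs. is_cdga C"
    and "\<forall>i. Suc i < length Cs \<longrightarrow> qlinked (Cs ! i) (Cs ! Suc i)"
    and "odd r" "Suc q = r + m" "massey_vanishing (last Cs) r m q"
  shows "massey_vanishing (hd Cs) r m q"
  using assms
proof (induction Cs rule: list_nonempty_induct)
  case (single C)
  then show ?case by simp
next
  case (cons C Cs)
  have "qlinked (Cs ! i) (Cs ! Suc i)" if "Suc i < length Cs" for i
    using cons.prems(2)[rule_format, of "Suc i"] that by simp
  then have "massey_vanishing (hd Cs) r m q" using cons by simp
  moreover have "qlinked C (hd Cs)"
    using cons.prems(2)[rule_format, of 0] cons.hyps by (simp add: hd_conv_nth)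
  ultimately show ?case
    using massey_vanishing_qlinked[of C "hd Cs"] cons by simp
qed

text \<open>The last algebra of the zigzag has zero differential, and the vanishing is carried back
  from it link by link, whichever way the quasi-isomorphisms point.\<close>

lemma formal_massey_vanishing:
  fixes A :: "('k::field_char_0, 'a) cdga"
  assumes A: "is_cdga A" and formal: "formal TYPE('c) A" and r: "odd r" "Suc q = r + m"
  shows "massey_vanishing A r m q"
proof -
  obtain Cs :: "('k, 'c) cdga list" where Cs: "Cs \<noteq> []" "\<forall>C\<in>set Cs. is_cdga C"
      "qlinked A (hd Cs)" "\<forall>i. Suc i < length Cs \<longrightarrow> qlinked (Cs ! i) (Cs ! Suc i)"
      "\<forall>n. \<forall>x\<in>gr (last Cs) n. df (last Cs) x = zr (last Cs)"
    using formal unfolding formal_def by blast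
  interpret last: comm_dga "last Cs" using Cs by unfold_locales auto
  have "massey_vanishing (last Cs) r m q"
    using last.massey_vanishing_zero_differential Cs by blast
  then have "massey_vanishing (hd Cs) r m q" using massey_vanishing_zigzag Cs r by blast
  then show ?thesis using massey_vanishing_qlinked A Cs r by (metis list.set_sel(1))
qed

subsection \<open>The extension by an odd generator\<close>

lemma (in comm_dga) sm_sm: "x \<in> gr A n \<Longrightarrow> sm A c (sm A e x) = sm A (c * e) x"
  by (simp add: sm_mult)

locale theta_extension = comm_dga +
  fixes w :: 'b and r :: nat
  assumes w: "cocycle A (2 * r) w" and odd_r: "odd r"
begin

abbreviation E where "E \<equiv> ext_theta A w r"

definition theta_deg :: nat where "theta_deg = 2 * r - 1"

text \<open>The coefficients b of the elements a + b theta of degree n.\<close>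

definition theta_coeffs :: "nat \<Rightarrow> 'b set" where
  "theta_coeffs n = (if theta_deg \<le> n then gr A (n - theta_deg) else {zr A})"

text \<open>Ensures that the truncated subtraction in \<open>theta_deg\<close> yields the true
  degree 2 r - 1 of theta.\<close>

lemma r_pos: "1 \<le> r"
  using odd_r by (cases r) auto

lemma w_in: "w \<in> gr A (2 * r)" and df_w: "df A w = zr A"
  using w by (auto simp: cocycle_def)

lemma w_comm: "x \<in> gr A n \<Longrightarrow> ml A w x = ml A x w"
  using ml_comm[OF w_in, of x n] sm_one[OF ml_in[OF _ w_in refl], of x n] by simp

text \<open>When n is below the degree of theta the truncated difference is 0, and the only
  coefficient, zero, does lie in degree 0.\<close>

lemma coeff_in: "b \<in> theta_coeffs n \<Longrightarrow> b \<in> gr A (n - theta_deg)"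
  by (auto simp: theta_coeffs_def split: if_splits)

lemma coeff_cases:
  assumes "b \<in> theta_coeffs n"
  obtains "b = zr A" | "theta_deg \<le> n" "b \<in> gr A (n - theta_deg)"
  using assms by (auto simp: theta_coeffs_def split: if_splits)

lemma zr_coeff [simp]: "zr A \<in> theta_coeffs n"
  by (simp add: theta_coeffs_def)

lemma ad_coeff: "b \<in> theta_coeffs n \<Longrightarrow> b' \<in> theta_coeffs n \<Longrightarrow> ad A b b' \<in> theta_coeffs n"
  by (auto simp: theta_coeffs_def ad_in split: if_splits)

lemma sm_coeff: "b \<in> theta_coeffs n \<Longrightarrow> sm A c b \<in> theta_coeffs n"
  by (auto simp: theta_coeffs_def sm_in split: if_splits)

lemma ml_coeff_right:
  assumes "a \<in> gr A m" "b \<in> theta_coeffs n" "k = m + n"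
  shows "ml A a b \<in> theta_coeffs k"
  using assms(2)
proof (cases rule: coeff_cases)
  case 1
  then show ?thesis using assms ml_zr_right by simp
next
  case 2
  then show ?thesis using assms ml_in[OF assms(1) 2(2)] by (simp add: theta_coeffs_def)
qed

lemma ml_coeff_left:
  assumes "b \<in> theta_coeffs n" "a \<in> gr A m" "k = n + m"
  shows "ml A b a \<in> theta_coeffs k"
  using assms(1)
proof (cases rule: coeff_cases)
  case 1
  then show ?thesis using assms ml_zr_left by simp
next
  case 2
  then show ?thesis using assms ml_in[OF 2(2) assms(2)] by (simp add: theta_coeffs_def)
qed

lemma ml_coeff_in:
  assumes "a \<in> gr A m" "b \<in> theta_coeffs n"
  shows "k = m + n \<Longrightarrow> ml A a b \<in> gr A (k - theta_deg)"
    and "k = n + m \<Longrightarrow> ml A b a \<in> gr A (k - theta_deg)"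
  by (simp_all add: coeff_in[OF ml_coeff_right[OF assms]] coeff_in[OF ml_coeff_left[OF assms(2,1)]])

lemma df_coeff: "b \<in> theta_coeffs n \<Longrightarrow> df A b \<in> theta_coeffs (Suc n)"
  using df_in[of b "n - theta_deg"] by (auto simp: theta_coeffs_def Suc_diff_le split: if_splits)

lemma ml_w_in:
  assumes "b \<in> theta_coeffs n"
  shows "ml A b w \<in> gr A (Suc n)"
  using assms
proof (cases rule: coeff_cases)
  case 1
  then show ?thesis using ml_zr_left w_in by simp
next
  case 2
  then show ?thesis using ml_in[OF 2(2) w_in] r_pos by (auto simp: theta_deg_def)
qed

text \<open>Theta has odd degree, so a coefficient has parity opposite to that of the whole element.
  Signs are from here on written in terms of the total degree n, which stays meaningful for a zero
  coefficient.\<close>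

lemma coeff_sign: "theta_deg \<le> n \<Longrightarrow> (-1) ^ (n - theta_deg) = - ((-1) ^ n :: 'a)"
  using r_pos by (cases "even n") (auto simp: theta_deg_def)

lemma coeff_comm:
  assumes "a \<in> gr A m" "b \<in> theta_coeffs n"
  shows "ml A a b = sm A ((-1) ^ (m * Suc n)) (ml A b a)"
  using assms(2)
proof (cases rule: coeff_cases)
  case 1
  then show ?thesis using assms by (simp add: ml_zr_left ml_zr_right)
next
  case 2
  have "(-1) ^ (m * (n - theta_deg)) = ((-1) ^ (m * Suc n) :: 'a)"
    using coeff_sign[OF 2(1)] by (simp only: mult.commute[of m] power_mult) simp
  then show ?thesis using ml_comm[OF assms(1) 2(2)] by simp
qed

lemma df_ml_coeff:
  assumes "b \<in> theta_coeffs n" "a \<in> gr A m"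
  shows "df A (ml A b a) = ad A (ml A (df A b) a) (sm A (- ((-1) ^ n)) (ml A b (df A a)))"
  using assms(1)
proof (cases rule: coeff_cases)
  case 1
  then show ?thesis using assms ml_zr_left[OF df_in[OF assms(2)]] ml_zr_left[OF assms(2)] by simp
next
  case 2
  then show ?thesis using df_ml[OF 2(2) assms(2)] coeff_sign[OF 2(1)] by simp
qed

section \<open>The operations of the extension in coordinates\<close>

lemma E_gr: "(a, b) \<in> gr E n \<longleftrightarrow> a \<in> gr A n \<and> b \<in> theta_coeffs n"
  by (auto simp: ext_theta_def Let_def theta_coeffs_def theta_deg_def)

lemma E_zr: "zr E = (zr A, zr A)"
  and E_un: "un E = (un A, zr A)"
  and E_ad: "ad E (a, b) (a', b') = (ad A a a', ad A b b')"
  and E_sm: "sm E c (a, b) = (sm A c a, sm A c b)"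
  by (simp_all add: ext_theta_def Let_def)

text \<open>Replaces \<open>deg\<close> by the actual degree n of a'. The two can disagree only for
  a' = 0, where the signed term vanishes.\<close>

lemma E_ml:
  assumes "b \<in> theta_coeffs m" "a' \<in> gr A n"
  shows "ml E (a, b) (a', b') = (ml A a a', ad A (ml A a b') (sm A ((-1) ^ n) (ml A b a')))"
proof (cases "a' = zr A")
  case True
  then show ?thesis using ml_zr_right[OF coeff_in[OF assms(1)]] by (simp add: ext_theta_def Let_def)
next
  case False
  then show ?thesis using deg_eq[OF assms(2)] by (simp add: ext_theta_def Let_def)
qed

lemma E_df:
  assumes "b \<in> theta_coeffs n"
  shows "df E (a, b) = (ad A (df A a) (sm A (- ((-1) ^ n)) (ml A b w)), df A b)"
proof (cases "b = zr A")
  case True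
  then show ?thesis using ml_zr_left[OF w_in] by (simp add: ext_theta_def Let_def)
next
  case False
  with assms have "theta_deg \<le> n" "b \<in> gr A (n - theta_deg)" by (auto elim: coeff_cases)
  then show ?thesis using deg_eq[OF _ False] coeff_sign by (simp add: ext_theta_def Let_def)
qed

text \<open>The theta-coefficient of both sides is a1 a2 b3 + (-1)^n3 a1 b2 a3 + (-1)^(n2 + n3) b1
  a2 a3, the signs coming from moving theta to the right.\<close>

lemma E_ml_assoc:
  assumes "(a1, b1) \<in> gr E n1" "(a2, b2) \<in> gr E n2" "(a3, b3) \<in> gr E n3"
  shows "ml E (ml E (a1, b1) (a2, b2)) (a3, b3) = ml E (a1, b1) (ml E (a2, b2) (a3, b3))"
proof -
  have a: "a1 \<in> gr A n1" "a2 \<in> gr A n2" "a3 \<in> gr A n3"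
    and b: "b1 \<in> theta_coeffs n1" "b2 \<in> theta_coeffs n2" "b3 \<in> theta_coeffs n3"
    using assms by (auto simp: E_gr)
  note bg = b[THEN coeff_in]
  let ?n = "n1 + n2 + n3"
  let ?P = "ml A a1 (ml A a2 b3)" and ?Q = "ml A a1 (ml A b2 a3)" and ?R = "ml A b1 (ml A a2 a3)"
  let ?e2 = "(-1) ^ n2 :: 'a" and ?e3 = "(-1) ^ n3 :: 'a"
  have mem: "ml A a1 b2 \<in> theta_coeffs (n1 + n2)" "ml A b1 a2 \<in> theta_coeffs (n1 + n2)"
      "ml A a2 b3 \<in> theta_coeffs (n2 + n3)" "ml A b2 a3 \<in> theta_coeffs (n2 + n3)"
      "ml A a2 a3 \<in> gr A (n2 + n3)"
    using a b by (auto intro: ml_coeff_left ml_coeff_right ml_in)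
  have g: "?P \<in> theta_coeffs ?n" "?Q \<in> theta_coeffs ?n" "?R \<in> theta_coeffs ?n"
    using mem a b by (auto intro: ml_coeff_left ml_coeff_right)
  note gg = g[THEN coeff_in]
  have l: "ad A (ml A a1 b2) (sm A ?e2 (ml A b1 a2)) \<in> theta_coeffs (n1 + n2)"
    using mem by (simp add: ad_coeff sm_coeff)
  have "ml E (ml E (a1, b1) (a2, b2)) (a3, b3) =
      (ml A (ml A a1 a2) a3,
       ad A (ml A (ml A a1 a2) b3)
         (sm A ?e3 (ml A (ad A (ml A a1 b2) (sm A ?e2 (ml A b1 a2))) a3)))"
    by (simp add: E_ml[OF b(1) a(2)] E_ml[OF l a(3)])
  also have "ml A (ad A (ml A a1 b2) (sm A ?e2 (ml A b1 a2))) a3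
      = ad A ?Q (sm A ?e2 ?R)"
    using ml_ad_left[OF coeff_in[OF mem(1)] coeff_in[OF sm_coeff[OF mem(2)]] a(3)]
      ml_sm_left[OF coeff_in[OF mem(2)] a(3)] ml_assoc[OF a(1) bg(2) a(3)] ml_assoc[OF bg(1) a(2,3)]
    by simp
  also have "ad A (ml A (ml A a1 a2) b3) (sm A ?e3 (ad A ?Q (sm A ?e2 ?R)))
      = ad A (ad A ?P (sm A ?e3 ?Q)) (sm A (?e2 * ?e3) ?R)"
    using gg ml_assoc[OF a(1,2) bg(3)]
    by (simp add: sm_ad[of _ "?n - theta_deg"] sm_in sm_sm[of _ "?n - theta_deg"] ad_assoc[of _ "?n - theta_deg"] mult.commute)
  finally have 1: "ml E (ml E (a1, b1) (a2, b2)) (a3, b3) =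
      (ml A (ml A a1 a2) a3, ad A (ad A ?P (sm A ?e3 ?Q)) (sm A (?e2 * ?e3) ?R))" .
  have "ml E (a1, b1) (ml E (a2, b2) (a3, b3)) =
      (ml A a1 (ml A a2 a3),
       ad A (ml A a1 (ad A (ml A a2 b3) (sm A ?e3 (ml A b2 a3)))) (sm A (?e2 * ?e3) ?R))"
    by (simp add: E_ml[OF b(2) a(3)] E_ml[OF b(1) mem(5)] power_add)
  also have "ml A a1 (ad A (ml A a2 b3) (sm A ?e3 (ml A b2 a3))) = ad A ?P (sm A ?e3 ?Q)"
    using ml_ad_right[OF coeff_in[OF mem(3)] coeff_in[OF sm_coeff[OF mem(4)]] a(1)]
      ml_sm_right[OF a(1) coeff_in[OF mem(4)]] by simp
  finally show ?thesis using 1 ml_assoc[OF a] by simp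
qed

lemma E_ml_comm:
  assumes "(a, b) \<in> gr E m" "(a', b') \<in> gr E n"
  shows "ml E (a, b) (a', b') = sm E ((-1) ^ (m * n)) (ml E (a', b') (a, b))"
proof -
  have a: "a \<in> gr A m" "a' \<in> gr A n" and b: "b \<in> theta_coeffs m" "b' \<in> theta_coeffs n"
    using assms by (auto simp: E_gr)
  let ?k = "m + n - theta_deg"
  have g: "ml A b' a \<in> gr A ?k" "ml A b a' \<in> gr A ?k"
    using ml_coeff_left[OF b(2) a(1), of "m + n"] ml_coeff_left[OF b(1) a(2), of "m + n"]
    by (auto dest: coeff_in)
  have "ad A (ml A a b') (sm A ((-1) ^ n) (ml A b a'))
    = sm A ((-1) ^ (m * n)) (ad A (ml A a' b) (sm A ((-1) ^ m) (ml A b' a)))"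
    unfolding coeff_comm[OF a(1) b(2)] coeff_comm[OF a(2) b(1)] using g
    by (cases "even m"; cases "even n")
      (simp_all add: sm_ad[of _ ?k] sm_in sm_sm[of _ ?k] sm_one[of _ ?k] ad_comm[of "ml A b a'" ?k]
        ad_comm[of "sm A (-1) (ml A b a')" ?k])
  then show ?thesis
    by (simp add: E_ml[OF b(1) a(2)] E_ml[OF b(2) a(1)] E_sm ml_comm[OF a])
qed

lemma E_ml_ad:
  assumes "(a, b) \<in> gr E m" "(a', b') \<in> gr E m" "(c, d) \<in> gr E n"
  shows "ml E (ad E (a, b) (a', b')) (c, d) = ad E (ml E (a, b) (c, d)) (ml E (a', b') (c, d))"
    and "ml E (c, d) (ad E (a, b) (a', b')) = ad E (ml E (c, d) (a, b)) (ml E (c, d) (a', b'))"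
proof -
  have a: "a \<in> gr A m" "a' \<in> gr A m" "c \<in> gr A n"
    and b: "b \<in> theta_coeffs m" "b' \<in> theta_coeffs m" "d \<in> theta_coeffs n"
    using assms by (auto simp: E_gr)
  note bg = b[THEN coeff_in]
  let ?k = "m + n - theta_deg"
  have g: "ml A a d \<in> gr A ?k" "ml A a' d \<in> gr A ?k" "ml A b c \<in> gr A ?k" "ml A b' c \<in> gr A ?k"
    "ml A d a \<in> gr A ?k" "ml A d a' \<in> gr A ?k" "ml A c b \<in> gr A ?k" "ml A c b' \<in> gr A ?k"
    using a b by (auto intro: ml_coeff_in)
  show "ml E (ad E (a, b) (a', b')) (c, d) = ad E (ml E (a, b) (c, d)) (ml E (a', b') (c, d))"
    using g by (simp add: E_ad E_ml[OF _ a(3)] E_ml[OF b(1) a(3)] E_ml[OF b(2) a(3)]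
        E_ml[OF ad_coeff[OF b(1,2)] a(3)] ml_ad_left[OF a(1,2,3)] ml_ad_left[OF a(1,2) bg(3)]
        ml_ad_left[OF bg(1,2) a(3)] sm_ad[of _ ?k] sm_in ad_medial[of _ ?k])
  show "ml E (c, d) (ad E (a, b) (a', b')) = ad E (ml E (c, d) (a, b)) (ml E (c, d) (a', b'))"
    using g by (simp add: E_ad E_ml[OF b(3) a(1)] E_ml[OF b(3) a(2)]
        E_ml[OF b(3) ad_in[OF a(1,2)]] ml_ad_right[OF a(1,2,3)] ml_ad_right[OF a(1,2) bg(3)]
        ml_ad_right[OF bg(1,2) a(3)] sm_ad[of _ ?k] sm_in ad_medial[of _ ?k])
qed

lemma E_ml_sm:
  assumes "(a, b) \<in> gr E m" "(a', b') \<in> gr E n"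
  shows "ml E (sm E c (a, b)) (a', b') = sm E c (ml E (a, b) (a', b'))"
    and "ml E (a, b) (sm E c (a', b')) = sm E c (ml E (a, b) (a', b'))"
proof -
  have a: "a \<in> gr A m" "a' \<in> gr A n" and b: "b \<in> theta_coeffs m" "b' \<in> theta_coeffs n"
    using assms by (auto simp: E_gr)
  note bg = b[THEN coeff_in]
  let ?k = "m + n - theta_deg"
  have g: "ml A a b' \<in> gr A ?k" "ml A b a' \<in> gr A ?k"
    using a b by (auto intro: ml_coeff_in)
  show "ml E (sm E c (a, b)) (a', b') = sm E c (ml E (a, b) (a', b'))"
    using g by (simp add: E_sm E_ml[OF b(1) a(2)] E_ml[OF sm_coeff[OF b(1)] a(2)]
        ml_sm_left[OF a(1,2)] ml_sm_left[OF a(1) bg(2)] ml_sm_left[OF bg(1) a(2)]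
        sm_ad[of _ ?k] sm_sm[of _ ?k] sm_in mult.commute)
  show "ml E (a, b) (sm E c (a', b')) = sm E c (ml E (a, b) (a', b'))"
    using g by (simp add: E_sm E_ml[OF b(1) a(2)] E_ml[OF b(1) sm_in[OF a(2)]]
        ml_sm_right[OF a(1,2)] ml_sm_right[OF a(1) bg(2)] ml_sm_right[OF bg(1) a(2)]
        sm_ad[of _ ?k] sm_sm[of _ ?k] sm_in mult.commute)
qed

lemma E_df_ad:
  assumes "(a, b) \<in> gr E n" "(a', b') \<in> gr E n"
  shows "df E (ad E (a, b) (a', b')) = ad E (df E (a, b)) (df E (a', b'))"
proof -
  have a: "a \<in> gr A n" "a' \<in> gr A n" and b: "b \<in> theta_coeffs n" "b' \<in> theta_coeffs n"
    using assms by (auto simp: E_gr)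
  have g: "ml A b w \<in> gr A (Suc n)" "ml A b' w \<in> gr A (Suc n)"
    "df A a \<in> gr A (Suc n)" "df A a' \<in> gr A (Suc n)"
    using a b by (auto intro: ml_w_in df_in)
  note bg = b[THEN coeff_in]
  show ?thesis
    using g by (simp add: E_ad E_df[OF b(1)] E_df[OF b(2)] E_df[OF ad_coeff[OF b]]
        df_ad[OF a] df_ad[OF bg] ml_ad_left[OF bg w_in] sm_ad[of _ "Suc n"] sm_in
        ad_medial[of _ "Suc n"])
qed

lemma E_df_sm:
  assumes "(a, b) \<in> gr E n"
  shows "df E (sm E c (a, b)) = sm E c (df E (a, b))"
proof -
  have a: "a \<in> gr A n" and b: "b \<in> theta_coeffs n" using assms by (auto simp: E_gr)
  have g: "ml A b w \<in> gr A (Suc n)" "df A a \<in> gr A (Suc n)"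
    using a b by (auto intro: ml_w_in df_in)
  note bg = coeff_in[OF b]
  show ?thesis
    using g by (simp add: E_sm E_df[OF b] E_df[OF sm_coeff[OF b]]
        df_sm[OF a] df_sm[OF bg] ml_sm_left[OF bg w_in] sm_ad[of _ "Suc n"] sm_in
        sm_sm[of _ "Suc n"] mult.commute)
qed

lemma E_df_in: "(a, b) \<in> gr E n \<Longrightarrow> df E (a, b) \<in> gr E (Suc n)"
  by (auto simp: E_gr E_df intro!: ad_in sm_in df_in ml_w_in df_coeff)

text \<open>As d w = 0, differentiating - (-1)^n b w gives - (-1)^n (d b) w. The coefficient d b,
  now part of an element of degree n + 1, contributes the same term with the opposite sign.\<close>

lemma E_df_df:
  assumes "(a, b) \<in> gr E n"
  shows "df E (df E (a, b)) = zr E"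
proof -
  have a: "a \<in> gr A n" and b: "b \<in> theta_coeffs n" using assms by (auto simp: E_gr)
  have g: "ml A b w \<in> gr A (Suc n)" "df A a \<in> gr A (Suc n)" "ml A (df A b) w \<in> gr A (Suc (Suc n))"
    using a b by (auto intro: ml_w_in df_in df_coeff)
  have dbw: "df A (ml A b w) = ml A (df A b) w"
    using df_ml_coeff[OF b w_in] ml_zr_right[OF coeff_in[OF b]] ad_zr_right[OF g(3)]
    by (simp add: df_w)
  have "ad A (sm A (- ((-1) ^ n)) (ml A (df A b) w)) (sm A ((-1) ^ n) (ml A (df A b) w)) = zr A"
    using sm_plus[OF g(3), of "- ((-1) ^ n)" "(-1) ^ n"] sm_zero[OF g(3)] by simp
  then show ?thesis
    using g
    by (simp add: E_df[OF b] E_df[OF df_coeff[OF b]] E_zr df_ad[of _ "Suc n"] df_df[OF a]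
        df_df[OF coeff_in[OF b]] df_sm[OF g(1)] dbw sm_in ad_zr_left[OF sm_in[OF g(3)]])
qed

lemma E_ml_in:
  assumes "(a, b) \<in> gr E m" "(a', b') \<in> gr E n"
  shows "ml E (a, b) (a', b') \<in> gr E (m + n)"
  using assms
  by (auto simp: E_gr E_ml intro!: ad_coeff sm_coeff intro: ml_in ml_coeff_left ml_coeff_right)

lemma E_leibniz:
  assumes "(a, b) \<in> gr E m" "(a', b') \<in> gr E n"
  shows "df E (ml E (a, b) (a', b')) =
    ad E (ml E (df E (a, b)) (a', b')) (sm E ((-1) ^ m) (ml E (a, b) (df E (a', b'))))"
proof -
  have a: "a \<in> gr A m" "a' \<in> gr A n" and b: "b \<in> theta_coeffs m" "b' \<in> theta_coeffs n"
    using assms by (auto simp: E_gr)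
  note bg = b[THEN coeff_in]
  define e f where "e = ((-1) ^ m :: 'a)" and "f = ((-1) ^ n :: 'a)"
  have ff: "f * f = 1" "f * (f * c) = c" for c
    by (simp_all add: f_def flip: power_mult_distrib mult.assoc)
  have mem: "df A a \<in> gr A (Suc m)" "df A a' \<in> gr A (Suc n)"
      "df A b \<in> theta_coeffs (Suc m)" "df A b' \<in> theta_coeffs (Suc n)"
      "ml A b w \<in> gr A (Suc m)" "ml A b' w \<in> gr A (Suc n)"
      "ml A a b' \<in> theta_coeffs (m + n)" "ml A b a' \<in> theta_coeffs (m + n)"
    using a b by (auto intro: df_in df_coeff ml_w_in ml_coeff_left ml_coeff_right)
  let ?k = "Suc (m + n)" and ?l = "Suc (m + n) - theta_deg"

  \<comment> \<open>The components without theta come first. All terms reduce to da a', a da', a b'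
    w and b a' w, because w has even degree and can be moved past a'.\<close>
  let ?P = "ml A (df A a) a'" and ?Q = "ml A a (df A a')" and ?R = "ml A a (ml A b' w)"
    and ?S = "ml A b (ml A a' w)"
  have S: "?S = ml A (ml A b a') w" "?S = ml A (ml A b w) a'"
    using ml_assoc[OF bg(1) a(2) w_in] ml_assoc[OF bg(1) w_in a(2)] w_comm[OF a(2)] by auto
  have R: "?R = ml A (ml A a b') w" using ml_assoc[OF a(1) bg(2) w_in] by simp
  have g1: "?P \<in> gr A ?k" "?Q \<in> gr A ?k" "?R \<in> gr A ?k" "?S \<in> gr A ?k"
    unfolding S(2) using mem a by (auto intro: ml_in)
  have "ad A (ad A ?P (sm A e ?Q)) (sm A (- (e * f)) (ad A ?R (sm A f ?S)))
      = ad A (ad A ?P (sm A (- e) ?S)) (sm A e (ad A ?Q (sm A (- f) ?R)))"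
    using g1 by (simp add: sm_ad[of _ ?k] sm_in sm_sm[of _ ?k] ad_assoc[of _ ?k]
        ad_left_comm[of _ ?k] ad_comm[of _ ?k] ad_in ff mult.assoc)
  moreover have "ml A (ad A (ml A a b') (sm A f (ml A b a'))) w = ad A ?R (sm A f ?S)"
    using ml_ad_left[OF coeff_in[OF mem(7)] coeff_in[OF sm_coeff[OF mem(8)]] w_in]
      ml_sm_left[OF coeff_in[OF mem(8)] w_in] S(1) R by simp
  moreover have "ml A (ad A (df A a) (sm A (- e) (ml A b w))) a' = ad A ?P (sm A (- e) ?S)"
    using ml_ad_left[OF mem(1) sm_in[OF mem(5)] a(2)] ml_sm_left[OF mem(5) a(2)] S(2) by simp
  moreover have "ml A a (ad A (df A a') (sm A (- f) (ml A b' w))) = ad A ?Q (sm A (- f) ?R)"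
    using ml_ad_right[OF mem(2) sm_in[OF mem(6)] a(1)] ml_sm_right[OF a(1) mem(6)] by simp
  moreover have "df A (ml A a a') = ad A ?P (sm A e ?Q)"
    using df_ml[OF a] by (simp add: e_def)
  ultimately have first: "ad A (df A (ml A a a'))
        (sm A (- (e * f)) (ml A (ad A (ml A a b') (sm A f (ml A b a'))) w))
      = ad A (ml A (ad A (df A a) (sm A (- e) (ml A b w))) a')
          (sm A e (ml A a (ad A (df A a') (sm A (- f) (ml A b' w)))))"
    by simp

  \<comment> \<open>Now the theta-coefficients. Each of the two products on the right turns one
    theta into w and yields a term b b' w, while the left side has none because theta squares to
    zero.\<close>
  let ?P = "ml A (df A a) b'" and ?Q = "ml A a (df A b')" and ?R = "ml A (df A b) a'"
    and ?S = "ml A b (df A a')" and ?U = "ml A b (ml A b' w)"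
  have U: "?U = ml A (ml A b w) b'"
    using ml_assoc[OF bg(1) w_in bg(2)] w_comm[OF bg(2)] by simp
  have "?P \<in> theta_coeffs ?k" "?Q \<in> theta_coeffs ?k" "?R \<in> theta_coeffs ?k"
      "?S \<in> theta_coeffs ?k" "?U \<in> theta_coeffs ?k"
    using mem a b by (auto intro: ml_coeff_left ml_coeff_right)
  note g2 = this[THEN coeff_in]
  \<comment> \<open>These two occurrences of b b' w carry opposite signs.\<close>
  have cancel: "ad A (sm A (- e) ?U) (sm A e ?U) = zr A"
    using sm_plus[OF g2(5), of "- e" e] sm_zero[OF g2(5)] by simp
  let ?L = "ad A (ad A ?P (sm A e ?Q)) (sm A f (ad A ?R (sm A (- e) ?S)))"
  have L: "?L \<in> gr A ?l" using g2 by (simp add: ad_in sm_in)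
  have "ad A (ad A (ad A ?P (sm A (- e) ?U)) (sm A f ?R))
          (sm A e (ad A ?Q (sm A (- f) (ad A ?S (sm A (- f) ?U)))))
      = ad A (ad A (sm A (- e) ?U) (sm A e ?U)) ?L"
    using g2 by (simp add: sm_ad[of _ ?l] sm_in sm_sm[of _ ?l] ad_assoc[of _ ?l]
        ad_left_comm[of _ ?l] ad_comm[of _ ?l] ad_in ff mult.assoc mult.commute[of f e])
  also have "\<dots> = ?L" using cancel ad_zr_left[OF L] by simp
  finally have "ad A (ad A (ad A ?P (sm A (- e) ?U)) (sm A f ?R))
          (sm A e (ad A ?Q (sm A (- f) (ad A ?S (sm A (- f) ?U))))) = ?L" .
  moreover have "ml A (ad A (df A a) (sm A (- e) (ml A b w))) b' = ad A ?P (sm A (- e) ?U)"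
    using ml_ad_left[OF mem(1) sm_in[OF mem(5)] bg(2)] ml_sm_left[OF mem(5) bg(2)] U by simp
  moreover have "ml A b (ad A (df A a') (sm A (- f) (ml A b' w))) = ad A ?S (sm A (- f) ?U)"
    using ml_ad_right[OF mem(2) sm_in[OF mem(6)] bg(1)] ml_sm_right[OF bg(1) mem(6)] by simp
  moreover have "df A (ad A (ml A a b') (sm A f (ml A b a'))) = ?L"
    using df_ad[OF coeff_in[OF mem(7)] coeff_in[OF sm_coeff[OF mem(8)]]]
      df_sm[OF coeff_in[OF mem(8)]] df_ml[OF a(1) bg(2)] df_ml_coeff[OF b(1) a(2)]
    by (simp add: e_def)
  ultimately have second: "df A (ad A (ml A a b') (sm A f (ml A b a')))
      = ad A (ad A (ml A (ad A (df A a) (sm A (- e) (ml A b w))) b') (sm A f ?R))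
          (sm A e (ad A ?Q (sm A (- f) (ml A b (ad A (df A a') (sm A (- f) (ml A b' w)))))))"
    by simp

  have ml': "ad A (ml A a b') (sm A f (ml A b a')) \<in> theta_coeffs (m + n)"
    using mem by (simp add: ad_coeff sm_coeff)
  have db': "ad A (df A a') (sm A (- f) (ml A b' w)) \<in> gr A (Suc n)"
    using mem by (simp add: ad_in sm_in)
  have sign: "(-1) ^ (m + n) = e * f" by (simp add: e_def f_def power_add)
  show ?thesis
    using first second
    by (simp add: E_ml[OF b(1) a(2)] E_ml[OF mem(3) a(2)] E_ml[OF b(1) db'] E_df[OF b(1)] E_df[OF b(2)]
        E_df[OF ml'] E_ad E_sm sign flip: e_def f_def)
qed

section \<open>The remaining axioms for the extension\<close>

lemma E_zr_in: "zr E \<in> gr E n"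
  by (simp add: E_zr E_gr)

lemma E_disjoint: "m \<noteq> n \<Longrightarrow> gr E m \<inter> gr E n \<subseteq> {zr E}"
proof (intro subsetI, elim IntE)
  fix x assume mn: "m \<noteq> n" and x: "x \<in> gr E m" "x \<in> gr E n"
  obtain a b where ab: "x = (a, b)" by fastforce
  have "a = zr A" using x ab mn gr_disjoint by (auto simp: E_gr)
  moreover have "b = zr A"
  proof (rule ccontr)
    assume "b \<noteq> zr A"
    then have "theta_deg \<le> m" "b \<in> gr A (m - theta_deg)" "theta_deg \<le> n" "b \<in> gr A (n - theta_deg)"
      using x ab by (auto simp: E_gr elim: coeff_cases)
    moreover from this have "m - theta_deg \<noteq> n - theta_deg" using mn by linarith
    ultimately show False using gr_disjoint \<open>b \<noteq> zr A\<close> by blast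
  qed
  ultimately show "x \<in> {zr E}" using ab by (simp add: E_zr)
qed

lemma E_ad_in: "(a, b) \<in> gr E n \<Longrightarrow> (a', b') \<in> gr E n \<Longrightarrow> ad E (a, b) (a', b') \<in> gr E n"
  by (simp add: E_gr E_ad ad_in ad_coeff)

lemma E_ad_comm: "(a, b) \<in> gr E n \<Longrightarrow> (a', b') \<in> gr E n \<Longrightarrow>
    ad E (a, b) (a', b') = ad E (a', b') (a, b)"
  by (auto simp: E_gr E_ad dest!: coeff_in elim!: ad_comm)

lemma E_ad_assoc: "(a, b) \<in> gr E n \<Longrightarrow> (a', b') \<in> gr E n \<Longrightarrow> (a'', b'') \<in> gr E n \<Longrightarrow>
    ad E (ad E (a, b) (a', b')) (a'', b'') = ad E (a, b) (ad E (a', b') (a'', b''))"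
  by (auto simp: E_gr E_ad dest!: coeff_in intro: ad_assoc)

lemma E_ad_zr: "(a, b) \<in> gr E n \<Longrightarrow> ad E (zr E) (a, b) = (a, b)"
  by (auto simp: E_gr E_ad E_zr dest!: coeff_in intro: ad_zr_left)

lemma E_ad_inverse: "(a, b) \<in> gr E n \<Longrightarrow> \<exists>a' b'. (a', b') \<in> gr E n \<and> ad E (a, b) (a', b') = zr E"
  by (rule exI[of _ "sm A (-1) a"], rule exI[of _ "sm A (-1) b"])
    (auto simp: E_gr E_ad E_zr sm_in sm_coeff dest: coeff_in intro: ad_neg_right)

lemma E_sm_in: "(a, b) \<in> gr E n \<Longrightarrow> sm E c (a, b) \<in> gr E n"
  by (simp add: E_gr E_sm sm_in sm_coeff)

lemma E_sm_ad: "(a, b) \<in> gr E n \<Longrightarrow> (a', b') \<in> gr E n \<Longrightarrow>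
    sm E c (ad E (a, b) (a', b')) = ad E (sm E c (a, b)) (sm E c (a', b'))"
  by (auto simp: E_gr E_ad E_sm dest!: coeff_in intro: sm_ad)

lemma E_sm_plus: "(a, b) \<in> gr E n \<Longrightarrow> sm E (c + e) (a, b) = ad E (sm E c (a, b)) (sm E e (a, b))"
  by (auto simp: E_gr E_ad E_sm dest!: coeff_in intro: sm_plus)

lemma E_sm_mult: "(a, b) \<in> gr E n \<Longrightarrow> sm E (c * e) (a, b) = sm E c (sm E e (a, b))"
  by (auto simp: E_gr E_sm dest!: coeff_in intro: sm_mult)

lemma E_sm_one: "(a, b) \<in> gr E n \<Longrightarrow> sm E 1 (a, b) = (a, b)"
  by (auto simp: E_gr E_sm dest!: coeff_in intro: sm_one)

lemma E_un_in: "un E \<in> gr E 0"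
  by (simp add: E_un E_gr un_in)

lemma E_ml_un: "(a, b) \<in> gr E n \<Longrightarrow> ml E (un E) (a, b) = (a, b)"
  by (auto simp: E_gr E_un E_ml[OF zr_coeff] ml_un ml_zr_left dest!: coeff_in intro: ad_zr_right)

lemma is_cdga_ext_theta: "is_cdga E"
  unfolding is_cdga_def Ball_def Bex_def split_paired_All split_paired_Ex
  by (intro conjI allI impI;
    (rule E_zr_in E_disjoint E_ad_in E_ad_comm E_ad_assoc E_ad_zr E_ad_inverse E_sm_in E_sm_ad
      E_sm_plus E_sm_mult E_sm_one E_ml_in E_ml_ad E_ml_sm E_ml_assoc E_un_in E_ml_un E_ml_comm
      E_df_in E_df_ad E_df_sm E_df_df E_leibniz; assumption))

end

subsection \<open>Division by the class of w\<close>

lemma (in comm_dga) coboundary_sub_trans: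
  assumes "x \<in> gr A n" "y \<in> gr A n" "z \<in> gr A n"
    and "coboundary A n (sub A x y)" "coboundary A n (sub A y z)"
  shows "coboundary A n (sub A x z)"
proof -
  have "sub A x z = ad A (sub A x y) (sub A y z)"
    unfolding sub_def using assms ad_neg_ad[OF assms(1,2)]
    by (simp add: ad_assoc[of _ n, symmetric] ad_in sm_in)
  then show ?thesis using coboundary_ad assms by simp
qed

lemma (in comm_dga) odd_left_anticomm:
  assumes "x \<in> gr A r" "y \<in> gr A r" "z \<in> gr A n" "odd r"
  shows "ml A x (ml A y z) = sm A (-1) (ml A y (ml A x z))"
proof -
  have "ml A x (ml A y z) = ml A (ml A x y) z" using ml_assoc[OF assms(1-3)] by simp
  also have "ml A x y = sm A (-1) (ml A y x)" using ml_comm[OF assms(1,2)] assms(4) by simp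
  also have "ml A (sm A (-1) (ml A y x)) z = sm A (-1) (ml A (ml A y x) z)"
    using ml_sm_left[OF ml_in[OF assms(2,1) refl] assms(3)] .
  finally show ?thesis using ml_assoc[OF assms(2,1,3)] by simp
qed

lemma (in comm_dga) gsum_in: "(\<And>i. i < k \<Longrightarrow> h i \<in> gr A n) \<Longrightarrow> gsum A h k \<in> gr A n"
  by (induction k) (auto intro: ad_in)

locale massey_vanishing_extension = theta_extension +
  fixes s :: nat
  assumes inj: "mult_cohom_inj A w s (s + 2 * r)"
    and surj: "mult_cohom_surj A w s (s + 2 * r)"
    and massey: "massey_vanishing (ext_theta A w r) r (r + s) (s + theta_deg)"
begin

text \<open>The cocycle u represents the class T a b z of the introduction.\<close>

definition quotient_by_w :: "'b \<Rightarrow> 'b \<Rightarrow> 'b \<Rightarrow> 'b \<Rightarrow> bool" where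
  "quotient_by_w a b z u \<longleftrightarrow>
     cocycle A s u \<and> coboundary A (s + 2 * r) (sub A (ml A w u) (ml A a (ml A b z)))"

lemma ml_ml_cocycle:
  assumes "cocycle A r a" "cocycle A r b" "cocycle A s z"
  shows "cocycle A (s + 2 * r) (ml A a (ml A b z))"
  by (rule cocycle_ml[OF assms(1) cocycle_ml[OF assms(2,3) refl]]) simp

lemma quotient_exists:
  assumes "cocycle A r a" "cocycle A r b" "cocycle A s z"
  shows "\<exists>u. quotient_by_w a b z u"
  using surj ml_ml_cocycle[OF assms]
  unfolding mult_cohom_surj_def quotient_by_w_def cohomologous_def by blast

lemma w_ml_in: "u \<in> gr A s \<Longrightarrow> ml A w u \<in> gr A (s + 2 * r)"
  by (rule ml_in[OF w_in]) auto

text \<open>In the extension a y becomes exact, since w u does and a y is cohomologous to it. The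
  theta-coefficient of any primitive is, up to sign, a class whose product with [w] is [a y], hence
  it is the class of u by injectivity. Vanishing of the Massey product in the extension, read off on
  theta-coefficients, then says that a u is exact. Here y is an arbitrary cocycle rather than a
  product b z, so that the statement can be polarised in a.\<close>

lemma massey_ext:
  assumes a: "cocycle A r a" and y: "cocycle A (r + s) y" and u: "cocycle A s u"
    and wu: "coboundary A (s + 2 * r) (sub A (ml A w u) (ml A a y))"
  shows "coboundary A (r + s) (ml A a u)"
proof -
  interpret E: comm_dga E by unfold_locales (rule is_cdga_ext_theta)
  \<comment> \<open>An element of degree \<open>?q\<close> = s + 2 r - 1 has its theta-coefficient b
    in degree s, and b enters the first component of its differential as \<open>?\<sigma>\<close> b
    w.\<close>
  let ?q = "s + theta_deg" and ?\<sigma> = "- ((-1) ^ (s + theta_deg)) :: 'a"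
  have \<sigma>: "?\<sigma> * ?\<sigma> = 1" by (simp flip: power_mult_distrib)
  have q: "Suc ?q = s + 2 * r" using r_pos by (simp add: theta_deg_def)
  note ag = cocycle_in[OF a] and yg = cocycle_in[OF y] and ug = cocycle_in[OF u]
  have coeffs: "theta_coeffs ?q = gr A s" by (simp add: theta_coeffs_def)
  have ay: "ml A a y \<in> gr A (s + 2 * r)" by (rule ml_in[OF ag yg]) simp
  have cocycle_E: "cocycle E n (x, zr A)" if "cocycle A n x" for n x
    using that cocycle_in[OF that] E_df[OF zr_coeff, of x n] ml_zr_left[OF w_in]
    by (simp add: cocycle_def E_gr E_zr)
  have ml_E: "ml E (a, zr A) (x, x') = (ml A a x, ml A a x')"
    if "x \<in> gr A n" "x' \<in> theta_coeffs n" for x x' n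
    using E_ml[OF zr_coeff that(1), of a x'] ml_zr_left[OF that(1)]
      ad_zr_right[OF ml_coeff_in(1)[OF ag that(2) refl]] by simp
  have ml_ay: "ml E (a, zr A) (y, zr A) = (ml A a y, zr A)"
    using ml_E[OF yg, of "zr A"] ml_zr_right[OF ag] by simp
  \<comment> \<open>With d e = w u - a y, the pair (- e, \<open>?\<sigma>\<close> u) is a primitive
    of a y: the first entry contributes a y - w u, and the second restores w u because the two
    factors \<open>?\<sigma>\<close> cancel.\<close>
  obtain e where e: "e \<in> gr A ?q" "df A e = sub A (ml A w u) (ml A a y)"
    using wu coboundary_Suc_iff[of ?q] q by metis
  have "df A (sm A (-1) e) = sub A (ml A a y) (ml A w u)"
    using df_sm[OF e(1)] e(2) sub_swap[OF w_ml_in[OF ug] ay] by simp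
  moreover have "sm A ?\<sigma> (ml A (sm A ?\<sigma> u) w) = ml A w u"
    using ml_sm_left[OF ug w_in, of ?\<sigma>] w_comm[OF ug] sm_sm[OF w_ml_in[OF ug], of ?\<sigma> ?\<sigma>] \<sigma>
      sm_one[OF w_ml_in[OF ug]] by simp
  moreover have "df A (sm A ?\<sigma> u) = zr A" using cocycle_sm[OF u] by (simp add: cocycle_def)
  moreover have "sm A ?\<sigma> u \<in> theta_coeffs ?q" using ug coeffs by (simp add: sm_in)
  ultimately have "df E (sm A (-1) e, sm A ?\<sigma> u) = (ml A a y, zr A)"
    using E_df[of "sm A ?\<sigma> u" ?q] ad_neg_ad[OF ay w_ml_in[OF ug]] by (simp add: sub_def)
  moreover have "(sm A (-1) e, sm A ?\<sigma> u) \<in> gr E ?q" using e ug coeffs by (simp add: E_gr sm_in)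
  ultimately have "coboundary E (r + (r + s)) (ml E (a, zr A) (y, zr A))"
    using E.coboundary_df[of "(sm A (-1) e, sm A ?\<sigma> u)" ?q "r + (r + s)"] q ml_ay by simp
  then obtain p where p: "p \<in> gr E ?q" "df E p = ml E (a, zr A) (y, zr A)"
      "coboundary E (r + ?q) (ml E (a, zr A) p)"
    using massey cocycle_E[OF a] cocycle_E[OF y]
    unfolding massey_vanishing_def null_massey_def by blast
  obtain p1 p2 where p12: "p = (p1, p2)" by fastforce
  have g: "p1 \<in> gr A ?q" "p2 \<in> gr A s" "p2 \<in> theta_coeffs ?q"
    using p(1) coeffs by (auto simp: p12 E_gr)
  have dp: "ad A (df A p1) (sm A ?\<sigma> (ml A p2 w)) = ml A a y" "df A p2 = zr A"
    using p(2) E_df[OF g(3), of p1] ml_ay by (auto simp: p12)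
  have "coboundary E (r + ?q) (ml A a p1, ml A a p2)"
    using p(3) ml_E[OF g(1,3)] by (simp add: p12)
  moreover have rq: "r + ?q = Suc (r - 1 + ?q)" using r_pos by simp
  \<comment> \<open>On theta-coefficients the differential of the extension is that of A, so the
    theta-coefficient of c is a primitive of a p2.\<close>
  ultimately obtain c where c: "c \<in> gr E (r - 1 + ?q)" "df E c = (ml A a p1, ml A a p2)"
    using E.coboundary_Suc_iff[of "r - 1 + ?q"] by metis
  obtain c1 c2 where c12: "c = (c1, c2)" by fastforce
  have c2: "c2 \<in> theta_coeffs (r - 1 + ?q)" using c(1) by (simp add: c12 E_gr)
  have "r - 1 + ?q - theta_deg = r - 1 + s" by linarith
  with coeff_in[OF c2] have "c2 \<in> gr A (r - 1 + s)" by (simp only:)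
  moreover have "df A c2 = ml A a p2" using c(2) E_df[OF c2, of c1] by (simp add: c12)
  moreover have "r + s = Suc (r - 1 + s)" using r_pos by linarith
  ultimately have ap2: "coboundary A (r + s) (ml A a p2)" using coboundary_df by metis
  \<comment> \<open>The first component of the equation for the differential of p reads a y - w v =
    d p1. Hence w u and w v are cohomologous, and injectivity identifies the classes of u and
    v.\<close>
  let ?v = "sm A ?\<sigma> p2"
  have v: "cocycle A s ?v" using g dp(2) cocycle_sm by (simp add: cocycle_def)
  note vg = cocycle_in[OF v]
  have wv: "sm A ?\<sigma> (ml A p2 w) = ml A w ?v"
    using w_comm[OF g(2)] ml_sm_right[OF w_in g(2)] by simp
  have dp1: "df A p1 \<in> gr A (s + 2 * r)" "coboundary A (s + 2 * r) (df A p1)"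
    using df_in[OF g(1)] coboundary_df[OF g(1)] q by simp_all
  have "sub A (ml A a y) (ml A w ?v) = df A p1"
    using dp(1) wv ad_ad_neg[OF dp1(1) w_ml_in[OF vg]] by (simp add: sub_def)
  then have "coboundary A (s + 2 * r) (sub A (ml A a y) (ml A w ?v))" using dp1(2) by simp
  then have "coboundary A (s + 2 * r) (sub A (ml A w u) (ml A w ?v))"
    using coboundary_sub_trans[OF w_ml_in[OF ug] ay w_ml_in[OF vg] wu] by blast
  then have "coboundary A (s + 2 * r) (ml A w (sub A u ?v))"
    using ml_sub_right[OF ug vg w_in] by simp
  then have "coboundary A s (sub A u ?v)"
    using inj cocycle_sub[OF u v] unfolding mult_cohom_inj_def by blast
  then have "coboundary A (r + s) (sub A (ml A a u) (ml A a ?v))"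
    using coboundary_ml_right[OF a] ml_sub_right[OF ug vg ag] by metis
  moreover have "coboundary A (r + s) (ml A a ?v)"
    using coboundary_sm[OF ap2] ml_sm_right[OF ag g(2)] by simp
  ultimately show ?thesis
    using coboundary_sub_cancel ml_in[OF ag ug refl] by blast
qed

lemma ml_quotient_self:
  assumes "cocycle A r a" "cocycle A r b" "cocycle A s z" "quotient_by_w a b z u"
  shows "coboundary A (r + s) (ml A a u)"
  using massey_ext[OF assms(1) cocycle_ml[OF assms(2,3) refl]] assms(4)
  unfolding quotient_by_w_def by blast

text \<open>Polarisation: u + v is the quotient belonging to a + c, so (a + c) (u + v) is exact, and
  the terms a v and c u are exact by \<open>ml_quotient_self\<close>.\<close>

lemma ml_quotient_alternating:
  assumes c: "cocycle A r a" "cocycle A r c" "cocycle A r b" "cocycle A s z"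
    and u: "quotient_by_w c b z u" and v: "quotient_by_w a b z v"
  shows "coboundary A (r + s) (ad A (ml A a u) (ml A c v))"
proof -
  let ?y = "ml A b z" and ?n = "s + 2 * r" and ?k = "r + s"
  have y: "cocycle A (r + s) ?y" using cocycle_ml c by blast
  have uv: "cocycle A s u" "cocycle A s v" using u v by (auto simp: quotient_by_w_def)
  note g = c[THEN cocycle_in] and yg = cocycle_in[OF y] and uvg = uv[THEN cocycle_in]
  have h: "ml A w u \<in> gr A ?n" "ml A w v \<in> gr A ?n" "ml A a ?y \<in> gr A ?n" "ml A c ?y \<in> gr A ?n"
    using w_ml_in uvg ml_in[OF g(1) yg, of ?n] ml_in[OF g(2) yg, of ?n] by auto
  have "sub A (ml A w (ad A u v)) (ml A (ad A a c) ?y)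
      = ad A (sub A (ml A w u) (ml A c ?y)) (sub A (ml A w v) (ml A a ?y))"
    unfolding sub_def ml_ad_right[OF uvg w_in] ml_ad_left[OF g(1,2) yg]
    using h by (simp add: sm_ad[of _ ?n] ad_assoc[of _ ?n] ad_left_comm[of _ ?n] ad_comm[of _ ?n]
        ad_in sm_in)
  then have "coboundary A ?n (sub A (ml A w (ad A u v)) (ml A (ad A a c) ?y))"
    using coboundary_ad u v by (simp add: quotient_by_w_def)
  then have "coboundary A ?k (ml A (ad A a c) (ad A u v))"
    using massey_ext[OF cocycle_ad[OF c(1,2)] y cocycle_ad[OF uv]] by blast
  moreover have k: "ml A a u \<in> gr A ?k" "ml A a v \<in> gr A ?k" "ml A c u \<in> gr A ?k" "ml A c v \<in> gr A ?k"
    using g uvg by (auto intro: ml_in)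
  have "ml A (ad A a c) (ad A u v)
      = ad A (ad A (ml A a u) (ml A c v)) (ad A (ml A a v) (ml A c u))"
    unfolding ml_ad_left[OF g(1,2) ad_in[OF uvg]] ml_ad_right[OF uvg g(1)] ml_ad_right[OF uvg g(2)]
    using k by (simp add: ad_assoc[of _ ?k] ad_left_comm[of _ ?k] ad_comm[of _ ?k] ad_in)
  moreover have "coboundary A ?k (ad A (ml A a v) (ml A c u))"
    using ml_quotient_self[OF c(1,3,4) v] ml_quotient_self[OF c(2,3,4) u] coboundary_ad by blast
  ultimately show ?thesis using coboundary_ad_cancel k ad_in by metis
qed

text \<open>This is the vanishing of the square of T x y: x anticommutes with y, and already x u is
  exact.\<close>

lemma quotient_square:
  assumes "cocycle A r x" "cocycle A r y" "cocycle A s z" "quotient_by_w x y z u"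
  shows "coboundary A (s + 2 * r) (ml A x (ml A y u))"
proof -
  have u: "u \<in> gr A s" using assms by (auto simp: quotient_by_w_def cocycle_def)
  have "coboundary A (s + 2 * r) (ml A y (ml A x u))"
    by (rule coboundary_ml_right[OF assms(2) ml_quotient_self[OF assms]]) simp
  then show ?thesis
    using coboundary_sm odd_left_anticomm[OF assms(1,2)[THEN cocycle_in] u odd_r] by simp
qed

text \<open>The operator T x' y' maps the kernel of T x y into itself; this is the form in which
  commutation of the operators enters the induction below.\<close>

lemma quotient_commutes:
  assumes c: "cocycle A r x" "cocycle A r y" "cocycle A r x'" "cocycle A r y'" "cocycle A s z"
    and xyz: "coboundary A (s + 2 * r) (ml A x (ml A y z))"
    and u: "quotient_by_w x' y' z u"
  shows "coboundary A (s + 2 * r) (ml A x (ml A y u))"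
proof -
  let ?n = "s + 2 * r"
  note g = c[THEN cocycle_in]
  \<comment> \<open>Put q = T y y' z and v = T x y' z. Alternation gives y u ~ - x' q and x q ~ - y
    v up to coboundaries. Hence x y u ~ - x x' q = x' x q, and it suffices that y v is
    exact.\<close>
  obtain q where q: "quotient_by_w y y' z q" using quotient_exists c by blast
  obtain v where v: "quotient_by_w x y' z v" using quotient_exists c by blast
  have "cocycle A s u" "cocycle A s q" "cocycle A s v" using u q v by (auto simp: quotient_by_w_def)
  note h = this this[THEN cocycle_in]
  have 1: "coboundary A (r + s) (ad A (ml A y u) (ml A x' q))"
    by (rule ml_quotient_alternating[OF c(2,3,4,5) u q])
  have 2: "coboundary A (r + s) (ad A (ml A x q) (ml A y v))"
    by (rule ml_quotient_alternating[OF c(1,2,4,5) q v])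
  have k: "ml A x (ml A y' z) \<in> gr A ?n" "ml A y (ml A x z) \<in> gr A ?n"
    using ml_ml_cocycle c cocycle_in by blast+
  have "sub A (ml A w (sm A (-1) v)) (ml A y' (ml A x z))
      = sm A (-1) (sub A (ml A w v) (ml A x (ml A y' z)))"
    using odd_left_anticomm[OF g(4,1,5) odd_r] ml_sm_right[OF w_in h(6)] k(1) w_ml_in[OF h(6)]
    by (simp add: sub_def sm_ad[of _ ?n] sm_in)
  then have v': "quotient_by_w y' x z (sm A (-1) v)"
    using v coboundary_sm cocycle_sm by (simp add: quotient_by_w_def)
  \<comment> \<open>The hypothesis on z means T y x z = 0, so zero serves as this quotient. Since T
    y' x z = - v, alternation in y and y' with x kept fixed shows that y v is exact.\<close>
  have "coboundary A ?n (ml A y (ml A x z))"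
    using odd_left_anticomm[OF g(2,1,5) odd_r] coboundary_sm[OF xyz] by simp
  then have "quotient_by_w y x z (zr A)"
    using coboundary_sub[OF coboundary_zr] ml_zr_right[OF w_in] by (simp add: quotient_by_w_def)
  then have "coboundary A (r + s) (ad A (ml A y (sm A (-1) v)) (ml A y' (zr A)))"
    by (rule ml_quotient_alternating[OF c(2,4,1,5) v'])
  moreover have yv: "ml A y v \<in> gr A (r + s)" using ml_in g(2) h(6) by blast
  ultimately have "coboundary A (r + s) (sm A (-1) (ml A y v))"
    using ml_zr_right[OF g(4)] ml_sm_right[OF g(2) h(6)] ad_zr_right[OF sm_in[OF yv]] by simp
  then have "coboundary A (r + s) (ml A y v)" using coboundary_neg_iff yv by blast
  then have "coboundary A (r + s) (ml A x q)"
    using coboundary_ad_cancel[OF 2] ml_in g(1) h(5) by blast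
  then have "coboundary A ?n (ml A x' (ml A x q))"
    by (rule coboundary_ml_right[OF c(3)]) simp
  then have 3: "coboundary A ?n (ml A x (ml A x' q))"
    using odd_left_anticomm[OF g(1,3) h(5) odd_r] coboundary_sm by simp
  have yu: "ml A y u \<in> gr A (r + s)" "ml A x' q \<in> gr A (r + s)" using ml_in g h by blast+
  have "coboundary A ?n (ml A x (ad A (ml A y u) (ml A x' q)))"
    by (rule coboundary_ml_right[OF c(1) 1]) simp
  then show ?thesis
    using coboundary_ad_cancel[OF _ 3] ml_ad_right[OF yu g(1)] ml_in[OF g(1) yu(1), of ?n] by simp
qed

text \<open>Induction on the number of operators. If the class z found for the first k operators is
  not killed by the next one, it is replaced by its image under that operator. The image is nonzero,
  is killed by the new operator because the square vanishes, and is still killed by the earlier ones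
  because they preserve kernels in the sense of \<open>quotient_commutes\<close>.\<close>

lemma annihilated_class:
  fixes k :: nat
  assumes xy: "\<And>i. i < k \<Longrightarrow> cocycle A r (xs i) \<and> cocycle A r (ys i)"
    and nz: "cohom_nonzero A s"
  shows "\<exists>z. cocycle A s z \<and> \<not> coboundary A s z
    \<and> (\<forall>i<k. coboundary A (s + 2 * r) (ml A (xs i) (ml A (ys i) z)))"
  using xy
proof (induction k)
  case 0
  then show ?case using nz by (auto simp: cohom_nonzero_def)
next
  case (Suc k)
  then obtain z where z: "cocycle A s z" "\<not> coboundary A s z"
      "\<And>i. i < k \<Longrightarrow> coboundary A (s + 2 * r) (ml A (xs i) (ml A (ys i) z))"
    by (metis less_Suc_eq)
  have c: "cocycle A r (xs k)" "cocycle A r (ys k)" using Suc.prems by auto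
  show ?case
  proof (cases "coboundary A (s + 2 * r) (ml A (xs k) (ml A (ys k) z))")
    case True
    then show ?thesis using z less_Suc_eq by auto
  next
    case False
    obtain u where u: "quotient_by_w (xs k) (ys k) z u" using quotient_exists c z(1) by blast
    have cu: "cocycle A s u" using u by (simp add: quotient_by_w_def)
    \<comment> \<open>An exact u would make w u exact, and with it the product of
      \<open>xs k\<close>, \<open>ys k\<close> and z, against the case assumption.\<close>
    have "\<not> coboundary A s u"
    proof
      assume "coboundary A s u"
      then have "coboundary A (s + 2 * r) (ml A w u)"
        by (rule coboundary_ml_right[OF w]) simp
      moreover have "coboundary A (s + 2 * r) (sub A (ml A (xs k) (ml A (ys k) z)) (ml A w u))"
        using coboundary_sub_sym[OF w_ml_in[OF cocycle_in[OF cu]]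
            cocycle_in[OF ml_ml_cocycle[OF c z(1)]]] u by (simp add: quotient_by_w_def)
      ultimately show False
        using False coboundary_sub_cancel cocycle_in[OF ml_ml_cocycle[OF c z(1)]] by blast
    qed
    moreover have "coboundary A (s + 2 * r) (ml A (xs i) (ml A (ys i) u))" if "i < Suc k" for i
    proof (cases "i = k")
      case True
      then show ?thesis using quotient_square[OF c z(1) u] by simp
    next
      case False
      then have "i < k" using that by simp
      then show ?thesis using quotient_commutes[OF _ _ c z(1) z(3) u] Suc.prems that by blast
    qed
    ultimately show ?thesis using cu by blast
  qed
qed

lemma coboundary_gsum_ml:
  fixes k :: nat
  assumes xy: "\<And>i. i < k \<Longrightarrow> cocycle A r (xs i) \<and> cocycle A r (ys i)" and z: "cocycle A s z"
    and "\<And>i. i < k \<Longrightarrow> coboundary A (s + 2 * r) (ml A (xs i) (ml A (ys i) z))"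
  shows "coboundary A (s + 2 * r) (ml A (gsum A (\<lambda>i. ml A (xs i) (ys i)) k) z)"
  using assms
proof (induction k)
  case 0
  then show ?case using ml_zr_left cocycle_in by fastforce
next
  case (Suc k)
  have xyg: "ml A (xs i) (ys i) \<in> gr A (2 * r)" if "i < Suc k" for i
    using Suc.prems(1)[OF that] ml_in[of "xs i" r "ys i" r "2 * r"] cocycle_in by auto
  have "gsum A (\<lambda>i. ml A (xs i) (ys i)) k \<in> gr A (2 * r)"
    by (rule gsum_in) (use xyg in simp)
  then have "ml A (gsum A (\<lambda>i. ml A (xs i) (ys i)) (Suc k)) z
      = ad A (ml A (gsum A (\<lambda>i. ml A (xs i) (ys i)) k) z) (ml A (ml A (xs k) (ys k)) z)"
    using ml_ad_left[OF _ xyg[of k] cocycle_in[OF z]] by simp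
  moreover have "ml A (ml A (xs k) (ys k)) z = ml A (xs k) (ml A (ys k) z)"
    using ml_assoc Suc.prems(1)[of k] z cocycle_in by blast
  ultimately show ?case using Suc coboundary_ad by simp
qed

text \<open>For a nonzero class z killed by all x_i y_i, the product w z is cohomologous to the sum
  of the x_i y_i z and hence exact, contradicting injectivity of multiplication by [w] in degree
  s.\<close>

lemma no_decomposition:
  fixes k :: nat
  assumes xy: "\<And>i. i < k \<Longrightarrow> cocycle A r (xs i) \<and> cocycle A r (ys i)"
    and w_sum: "cohomologous A (2 * r) w (gsum A (\<lambda>i. ml A (xs i) (ys i)) k)"
    and nz: "cohom_nonzero A s"
  shows False
proof -
  let ?g = "gsum A (\<lambda>i. ml A (xs i) (ys i)) k"
  obtain z where z: "cocycle A s z" "\<not> coboundary A s z"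
      "\<And>i. i < k \<Longrightarrow> coboundary A (s + 2 * r) (ml A (xs i) (ml A (ys i) z))"
    using annihilated_class[of k xs ys, OF xy nz] by blast
  note zg = cocycle_in[OF z(1)]
  have g: "?g \<in> gr A (2 * r)" "coboundary A (2 * r) (sub A w ?g)"
    using w_sum by (auto simp: cohomologous_def cocycle_def)
  have "coboundary A (s + 2 * r) (ml A (sub A w ?g) z)"
    by (rule coboundary_ml_left[OF g(2) z(1)]) simp
  then have "coboundary A (s + 2 * r) (sub A (ml A w z) (ml A ?g z))"
    using ml_sub_left[OF w_in g(1) zg] by simp
  then have "coboundary A (s + 2 * r) (ml A w z)"
    using coboundary_sub_cancel coboundary_gsum_ml[of k xs ys, OF xy z(1) z(3)] w_ml_in[OF zg] by blast
  then show False using inj z(1,2) unfolding mult_cohom_inj_def by blast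
qed

end

theorem theorem4p2:
  fixes M :: "('k::field_char_0, 'a) cdga" and w :: 'a and r s :: nat
  assumes "sullivan_minimal M"
    and "cocycle M (2 * r) w"
    and "odd r"
    and "\<exists>k xs ys. (\<forall>i<k. cocycle M r (xs i) \<and> cocycle M r (ys i))
            \<and> cohomologous M (2 * r) w (gsum M (\<lambda>i. ml M (xs i) (ys i)) k)"
    and "cohom_nonzero M s"
    and "mult_cohom_inj M w s (s + 2 * r)" and "mult_cohom_surj M w s (s + 2 * r)"
    and "r \<le> s \<longrightarrow> mult_cohom_inj M w (s - r) (s + r)"
  shows "\<not> formal TYPE('c) (ext_theta M w r)"
proof
  assume formal: "formal TYPE('c) (ext_theta M w r)"
  interpret theta_extension M w r
    using assms by unfold_locales (auto simp: sullivan_minimal_def)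
  \<comment> \<open>The Massey products to be used have a in degree r and y in degree r + s, so the
    primitives of a y lie in degree s + 2 r - 1 and have theta-coefficients in degree s.\<close>
  have "Suc (s + theta_deg) = r + (r + s)" using r_pos by (simp add: theta_deg_def)
  then have "massey_vanishing (ext_theta M w r) r (r + s) (s + theta_deg)"
    using formal_massey_vanishing[OF is_cdga_ext_theta formal odd_r] by blast
  then interpret massey_vanishing_extension M w r s
    using assms by unfold_locales auto
  show False using no_decomposition assms(4,5) by blast
qed

end
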